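(* Consider the dual gradient flow $$x(t)=\nabla\mathcal R^*(A^*\lambda(t)),\qquad \frac{d}{dt}\lambda(t)=y^\delta-Ax(t),\quad t>0,$$ with $\lambda(0)=0$, driven by noisy data $y^\delta$ with $\|y^\delta-y\|\le\delta$. If $t_\delta>0$ is chosen such that $t_\delta\to\infty$ and $\delta^2t_\delta\to0$ as $\delta\to0$, then $$\mathcal R(x(t_\delta))\to\mathcal R(x^\dagger)\quad\text{and}\quad D_{\mathcal R}^{\xi(t_\delta)}(x^\dagger,x(t_\delta))\to0\qquad\text{as }\delta\to0,$$ where $\xi(t):=A^*\lambda(t)$. Consequently $\|x(t_\delta)-x^\dagger\|\to0$ as $\delta\to0$.
   Context: Standing setting. $X$ is a Banach space, $Y$ is a Hilbert space (identified with its dual), $A:X\to Y$ is a bounded linear operator with adjoint $A^*:Y\to X^*$. $\mathcal R:X\to(-\infty,\infty]$ is proper, lower semi-continuous, and strongly convex in the sense that there is a constant $c_0>0$ with $$\mathcal R(\gamma x+(1-\gamma)x')+c_0\gamma(1-\gamma)\|x-x'\|^2\le\gamma\mathcal R(x)+(1-\gamma)\mathcal R(x')$$ for all $x,x'\in\mathrm{dom}(\mathcal R)$ and $0\le\gamma\le1$; moreover each sublevel set of $\mathcal R$ is weakly compact in $X$. Here $\mathrm{dom}(\mathcal R)=\{x:\mathcal R(x)<\infty\}$. The exact datum $y\in Y$ is such that $Ax=y$ has a solution in $\mathrm{dom}(\mathcal R)$. Under these assumptions there is a unique $\mathcal R$-minimizing solution $x^\dagger$, i.e. $Ax^\dagger=y$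 and $\mathcal R(x^\dagger)=\min\{\mathcal R(x):x\in X,\ Ax=y\}$. Noisy data: for each noise level $\delta>0$, $y^\delta\in Y$ satisfies $\|y^\delta-y\|\le\delta$; the flow (and so $x(t)$, $\lambda(t)$) depends on $y^\delta$, although this is suppressed in the notation. $\mathcal R^*(\xi):=\sup_{x\in X}\{\langle\xi,x\rangle-\mathcal R(x)\}$, $\xi\in X^*$, is the Legendre–Fenchel conjugate. Under the assumptions $\mathcal R^*$ is finite and Fréchet differentiable on $X^*$, with $\nabla\mathcal R^*:X^*\to X$ Lipschitz continuous, and for any initial value $\lambda(0)\in Y$ the flow has a unique solution $(x,\lambda)\in C([0,\infty),X)\times C^1([0,\infty),Y)$. One has $A^*\lambda(t)\in\partial\mathcal R(x(t))$, where $\partial\mathcal R(x)=\{\xi\in X^*:\mathcal R(x')\ge\mathcal R(x)+\langle\xi,x'-x\rangle\ \forall x'\in X\}$. Bregman distance: for $\xi\in\partial\mathcal R(x)$, $D_{\mathcal R}^{\xi}(x',x):=\mathcal R(x')-\mathcal R(x)-\langle\xi,x'-x\rangle$. *)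

theory Defs
  imports "HOL-Analysis.Analysis"
begin

text \<open>The topological dual of a real Banach space \<open>'x\<close> is \<open>'x \<Rightarrow>\<^sub>L real\<close>; a real Hilbert space is a type of
  sort \<open>{real_inner, banach}\<close>.\<close>

definition dual_adjoint ::
    "('x::real_normed_vector \<Rightarrow>\<^sub>L 'y::real_inner) \<Rightarrow> 'y \<Rightarrow> ('x \<Rightarrow>\<^sub>L real)" where
  "dual_adjoint A l = blinfun_inner_right l o\<^sub>L A"

lemma dual_adjoint_apply:
  "blinfun_apply (dual_adjoint A l) x = inner l (blinfun_apply A x)"
  by (simp add: dual_adjoint_def)

text \<open>The coarsest topology making every bounded linear functional continuous.\<close>
definition weak_topology :: "'x::real_normed_vector topology" where
  "weak_topology =
     topology_generated_by {blinfun_apply \<xi> -` U | (\<xi> :: 'x \<Rightarrow>\<^sub>L real) U. open U}"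

definition proper_fun :: "('x \<Rightarrow> ereal) \<Rightarrow> bool" where
  "proper_fun R \<longleftrightarrow> (\<forall>x. R x \<noteq> -\<infinity>) \<and> (\<exists>x. R x < \<infinity>)"

definition lower_semicontinuous :: "('x::topological_space \<Rightarrow> ereal) \<Rightarrow> bool" where
  "lower_semicontinuous R \<longleftrightarrow> (\<forall>x. R x \<le> Liminf (at x) R)"

definition strongly_convex :: "real \<Rightarrow> ('x::real_normed_vector \<Rightarrow> ereal) \<Rightarrow> bool" where
  "strongly_convex c R \<longleftrightarrow>
     (\<forall>x x' \<gamma>. R x < \<infinity> \<longrightarrow> R x' < \<infinity> \<longrightarrow> 0 \<le> \<gamma> \<longrightarrow> \<gamma> \<le> 1 \<longrightarrow>
        R (\<gamma> *\<^sub>R x + (1 - \<gamma>) *\<^sub>R x') + ereal (c * \<gamma> * (1 - \<gamma>) * (norm (x - x'))\<^sup>2)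
          \<le> ereal \<gamma> * R x + ereal (1 - \<gamma>) * R x')"

definition conjugate ::
    "('x::real_normed_vector \<Rightarrow> ereal) \<Rightarrow> ('x \<Rightarrow>\<^sub>L real) \<Rightarrow> ereal" where
  "conjugate R \<xi> = (SUP x. ereal (blinfun_apply \<xi> x) - R x)"

text \<open>\<open>gradient_at F \<xi> x\<close>: the functional \<open>F\<close> on the dual is finite near \<open>\<xi>\<close>, and its Frechet
  derivative at \<open>\<xi>\<close>, an element of the bidual, is evaluation at the point \<open>x\<close> of the space itself.\<close>
definition gradient_at ::
    "(('x::real_normed_vector \<Rightarrow>\<^sub>L real) \<Rightarrow> ereal) \<Rightarrow> ('x \<Rightarrow>\<^sub>L real) \<Rightarrow> 'x \<Rightarrow> bool" where
  "gradient_at F \<xi> x \<longleftrightarrow>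
     (\<forall>\<^sub>F \<eta> in nhds \<xi>. \<bar>F \<eta>\<bar> \<noteq> \<infinity>) \<and>
     ((\<lambda>\<eta>. real_of_ereal (F \<eta>)) has_derivative (\<lambda>h. blinfun_apply h x)) (at \<xi>)"

definition gradient ::
    "(('x::real_normed_vector \<Rightarrow>\<^sub>L real) \<Rightarrow> ereal) \<Rightarrow> ('x \<Rightarrow>\<^sub>L real) \<Rightarrow> 'x" where
  "gradient F \<xi> = (THE x. gradient_at F \<xi> x)"

definition minimizing_solution ::
    "('x::real_normed_vector \<Rightarrow> ereal) \<Rightarrow> ('x \<Rightarrow>\<^sub>L 'y::real_normed_vector) \<Rightarrow> 'y \<Rightarrow> 'x \<Rightarrow> bool" where
  "minimizing_solution R A y x \<longleftrightarrow>
     blinfun_apply A x = y \<and> (\<forall>x'. blinfun_apply A x' = y \<longrightarrow> R x \<le> R x')"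

text \<open>The two clauses before the equations say that the solution has the regularity
  \<open>C([0,\<infinity>), X) \<times> C\<^sup>1([0,\<infinity>), Y)\<close>, the derivative at \<open>0\<close> being one-sided.\<close>
definition dual_gradient_flow ::
    "('x::real_normed_vector \<Rightarrow> ereal) \<Rightarrow> ('x \<Rightarrow>\<^sub>L 'y::real_inner) \<Rightarrow> 'y \<Rightarrow>
     (real \<Rightarrow> 'x) \<Rightarrow> (real \<Rightarrow> 'y) \<Rightarrow> bool" where
  "dual_gradient_flow R A y x l \<longleftrightarrow>
     continuous_on {0..} x \<and>
     (\<exists>l'. continuous_on {0..} l' \<and>
           (\<forall>t\<ge>0. (l has_vector_derivative l' t) (at t within {0..}))) \<and>
     (\<forall>t>0. x t = gradient (conjugate R) (dual_adjoint A (l t))) \<and>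
     (\<forall>t>0. (l has_vector_derivative (y - blinfun_apply A (x t))) (at t))"

text \<open>Only meaningful when \<open>\<xi>\<close> is a subgradient of \<open>R\<close> at \<open>x\<close>; then \<open>R x\<close> is finite for proper \<open>R\<close>, so
  the extended-real subtraction is not of the form \<open>\<infinity> - \<infinity>\<close>.\<close>
definition bregman ::
    "('x::real_normed_vector \<Rightarrow> ereal) \<Rightarrow> ('x \<Rightarrow>\<^sub>L real) \<Rightarrow> 'x \<Rightarrow> 'x \<Rightarrow> ereal" where
  "bregman R \<xi> x' x = R x' - R x - ereal (blinfun_apply \<xi> (x' - x))"

end

theory Submission
  imports Defs
begin

text \<open>
  Write \<open>\<lambda>\<close>, \<open>x\<close> for the flow at time \<open>t\<close>, \<open>N = \<parallel>\<lambda> - \<mu>\<parallel>\<close>, and \<open>D\<close> for the Bregman distance of \<open>x\<^sup>\<dagger>\<close> from \<open>x\<close>.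
  The flow is the gradient flow of the convex dual function \<open>F \<lambda> = R\<^sup>* (A\<^sup>* \<lambda>) - \<langle>\<lambda>, y\<^sup>\<delta>\<rangle>\<close>, whose
  gradient at \<open>\<lambda>\<close> is the residual \<open>g = A x - y\<^sup>\<delta>\<close>. Three facts are combined.

  First, for a gradient flow started at \<open>0\<close> and any comparison point \<open>\<mu>\<close>, the quantity
  \<open>s (F \<lambda> - F \<mu>) + \<parallel>\<lambda> - \<mu>\<parallel>\<^sup>2/2 + s\<^sup>2 \<parallel>g(t)\<parallel>\<^sup>2/2\<close>, evaluated along the flow at time \<open>s\<close>, does not increase
  on \<open>[0, t]\<close>, because the speed \<open>\<parallel>g\<parallel>\<close> is nonincreasing in time (\<open>gradient_flow_estimate\<close>).

  Secondly, strong duality holds: for every \<open>e > 0\<close> some \<open>\<mu>\<close> satisfies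
  \<open>R\<^sup>* (A\<^sup>* \<mu>) - \<langle>\<mu>, y\<rangle> \<le> e - R x\<^sup>\<dagger>\<close> (\<open>approximate_lagrange_multiplier\<close>). A dual maximiser need not exist,
  so \<open>\<mu>\<close> depends on \<open>e\<close>; it is read off from the minimiser of \<open>R u + (n/2) \<parallel>A u - y\<parallel>\<^sup>2\<close> for large \<open>n\<close>.

  Thirdly, the Fenchel equality turns the dual gap into the Bregman distance:
  \<open>D = R x\<^sup>\<dagger> + R\<^sup>* (A\<^sup>* \<lambda>) - \<langle>\<lambda>, y\<rangle>\<close>. Hence \<open>F \<lambda> - F \<mu> \<ge> D - e - \<delta> N\<close>, and after absorbing
  \<open>\<delta> N \<le> N\<^sup>2/(4t) + \<delta>\<^sup>2 t\<close> the first fact becomes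
  \<open>D + N\<^sup>2/(4t) + t \<parallel>g\<parallel>\<^sup>2/2 \<le> E\<close> with \<open>E = \<parallel>\<mu>\<parallel>\<^sup>2/(2t) + e + \<delta>\<^sup>2 t\<close>. This bounds \<open>D\<close>, and also
  \<open>R x\<^sup>\<dagger> - R x = D + \<langle>\<lambda>, y - A x\<rangle>\<close>, since \<open>\<parallel>\<lambda>\<parallel> (\<delta> + \<parallel>g\<parallel>)\<close> is controlled by the product of the square
  roots of \<open>\<parallel>\<lambda>\<parallel>\<^sup>2/t\<close> and \<open>t (\<delta> + \<parallel>g\<parallel>)\<^sup>2\<close>. For fixed \<open>e\<close> the parameter choice gives \<open>E \<rightarrow> e\<close>, and \<open>e\<close> is
  arbitrary. Strong convexity finally gives \<open>c\<^sub>0 \<parallel>x - x\<^sup>\<dagger>\<parallel>\<^sup>2 \<le> D\<close>.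

  Before this, the gradient of \<open>R\<^sup>*\<close> must be identified. It is specified through its action on all
  functionals, so its uniqueness is the statement that the dual separates points, a form of the
  Hahn-Banach theorem (\<open>blinfun_separates_points\<close>). Its existence comes from the quadratic growth of
  \<open>R - \<xi>\<close> around its minimiser, which makes \<open>R\<^sup>*\<close> differentiable with a quadratic remainder.
\<close>

section \<open>The dual space separates points\<close>

definition sublinear :: "('a::real_vector \<Rightarrow> real) \<Rightarrow> bool" where
  "sublinear p \<longleftrightarrow>
     (\<forall>x y. p (x + y) \<le> p x + p y) \<and> (\<forall>a x. 0 \<le> a \<longrightarrow> p (a *\<^sub>R x) = a * p x)"

lemma sublinear_add: "sublinear p \<Longrightarrow> p (x + y) \<le> p x + p y"
  and sublinear_scale: "sublinear p \<Longrightarrow> 0 \<le> a \<Longrightarrow> p (a *\<^sub>R x) = a * p x"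
  by (auto simp: sublinear_def)

lemma sublinear_zero: "sublinear p \<Longrightarrow> p 0 = 0"
  using sublinear_scale[of p 0 0] by simp

lemma sublinear_ge_minus: "sublinear p \<Longrightarrow> - p (- x) \<le> p x"
  using sublinear_add[of p x "- x"] by (simp add: sublinear_zero)

text \<open>The largest sublinear functional below \<open>p\<close> that is at most \<open>- p v\<close> at \<open>- v\<close>, if \<open>p\<close> is sublinear.
It is therefore linear along the line through \<open>v\<close>.\<close>

definition flatten :: "('a::real_vector \<Rightarrow> real) \<Rightarrow> 'a \<Rightarrow> 'a \<Rightarrow> real" where
  "flatten p v x = (INF s\<in>{0..}. p (x + s *\<^sub>R v) - s * p v)"

context
  fixes p :: "'a::real_vector \<Rightarrow> real" and v :: 'a
  assumes p: "sublinear p"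
begin

lemma flatten_term_ge: "0 \<le> s \<Longrightarrow> - p (- x) \<le> p (x + s *\<^sub>R v) - s * p v"
  using sublinear_add[OF p, of "x + s *\<^sub>R v" "- x"] sublinear_scale[OF p, of s v] by simp

lemma flatten_bdd: "bdd_below ((\<lambda>s. p (x + s *\<^sub>R v) - s * p v) ` {0..})"
  by (rule bdd_belowI2[where m="- p (- x)"]) (use flatten_term_ge in auto)

lemma flatten_le: "0 \<le> s \<Longrightarrow> flatten p v x \<le> p (x + s *\<^sub>R v) - s * p v"
  unfolding flatten_def by (rule cINF_lower[OF flatten_bdd]) auto

lemma flatten_ge: "(\<And>s. 0 \<le> s \<Longrightarrow> m \<le> p (x + s *\<^sub>R v) - s * p v) \<Longrightarrow> m \<le> flatten p v x"
  unfolding flatten_def by (rule cINF_greatest) auto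

lemma flatten_le_self: "flatten p v x \<le> p x"
  using flatten_le[of 0 x] by simp

lemma flatten_uminus: "flatten p v (- v) \<le> - p v"
  using flatten_le[of 1 "- v"] by (simp add: sublinear_zero[OF p])

lemma sublinear_flatten: "sublinear (flatten p v)"
proof -
  have "flatten p v (x + y) \<le> flatten p v x + flatten p v y" for x y
  proof -
    have "flatten p v (x + y) - (p (y + s' *\<^sub>R v) - s' * p v) \<le> p (x + s *\<^sub>R v) - s * p v"
      if "0 \<le> s" "0 \<le> s'" for s s'
      using flatten_le[of "s + s'" "x + y"] that sublinear_add[OF p, of "x + s *\<^sub>R v" "y + s' *\<^sub>R v"]
      by (simp add: algebra_simps)
    then have "flatten p v (x + y) - (p (y + s' *\<^sub>R v) - s' * p v) \<le> flatten p v x" if "0 \<le> s'" for s'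
      using that by (intro flatten_ge) auto
    then have "flatten p v (x + y) - flatten p v x \<le> flatten p v y"
      by (intro flatten_ge) (auto simp: algebra_simps)
    then show ?thesis by simp
  qed
  moreover have pos: "flatten p v (a *\<^sub>R x) \<le> a * flatten p v x" if "0 < a" for a x
  proof -
    have "flatten p v (a *\<^sub>R x) / a \<le> p (x + s *\<^sub>R v) - s * p v" if "0 \<le> s" for s
    proof -
      have "flatten p v (a *\<^sub>R x) \<le> p (a *\<^sub>R x + (a * s) *\<^sub>R v) - a * s * p v"
        using that \<open>0 < a\<close> by (intro flatten_le) simp
      also have "a *\<^sub>R x + (a * s) *\<^sub>R v = a *\<^sub>R (x + s *\<^sub>R v)"
        by (simp add: scaleR_add_right)
      also have "p \<dots> = a * p (x + s *\<^sub>R v)"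
        using sublinear_scale[OF p] \<open>0 < a\<close> by simp
      finally show ?thesis using \<open>0 < a\<close> by (simp add: field_simps)
    qed
    then have "flatten p v (a *\<^sub>R x) / a \<le> flatten p v x" by (intro flatten_ge) auto
    then show ?thesis using \<open>0 < a\<close> by (simp add: field_simps)
  qed
  moreover have "flatten p v (a *\<^sub>R x) = a * flatten p v x" if "0 \<le> a" for a x
  proof (cases "a = 0")
    case True
    have "flatten p v 0 = 0"
      using flatten_le_self[of 0] flatten_ge[of 0 0] flatten_term_ge[of _ 0] sublinear_zero[OF p]
      by (intro antisym) auto
    then show ?thesis using True by simp
  next
    case False
    then have "0 < a" using that by simp
    then show ?thesis
      using pos[of a x] pos[of "inverse a" "a *\<^sub>R x"] by (simp add: field_simps)
  qed
  ultimately show ?thesis by (auto simp: sublinear_def)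
qed

end

text \<open>Flattening a minimal functional along \<open>v\<close> cannot change it, so \<open>p (- v) = - p v\<close> for every \<open>v\<close>, and an
odd sublinear functional is linear.\<close>

lemma minimal_sublinear_linear:
  assumes p: "sublinear p" and min: "\<And>q. sublinear q \<Longrightarrow> q \<le> p \<Longrightarrow> q = p"
  shows "linear p"
proof -
  have neg: "p (- v) = - p v" for v
  proof -
    have "flatten p v = p"
      using min[OF sublinear_flatten[OF p, of v]] flatten_le_self[OF p] by (auto simp: le_fun_def)
    then show ?thesis
      using flatten_uminus[OF p, of v] sublinear_ge_minus[OF p, of "- v"] by simp
  qed
  show ?thesis
  proof (rule linearI)
    fix x y
    show "p (x + y) = p x + p y"
      using sublinear_add[OF p, of x y] sublinear_add[OF p, of "- x" "- y"] neg[of "x + y"]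
      by (simp add: neg)
  next
    fix r x
    show "p (r *\<^sub>R x) = r *\<^sub>R p x"
      using sublinear_scale[OF p, of r x] sublinear_scale[OF p, of "- r" x] neg[of "r *\<^sub>R x"]
      by (cases "0 \<le> r") auto
  qed
qed

text \<open>Zorn's lemma for the reversed pointwise order. The infimum of a chain is finite because each member
is bounded below by \<open>- q (- x)\<close>, and it is subadditive because two members can be replaced by the
smaller one.\<close>

lemma ex_minimal_sublinear:
  assumes q: "sublinear q"
  obtains p where "sublinear p" "p \<le> q" "\<And>p'. sublinear p' \<Longrightarrow> p' \<le> p \<Longrightarrow> p' = p"
proof -
  let ?S = "{p. sublinear p \<and> p \<le> q}" and ?P = "\<lambda>p p'. p' \<le> p"
  have "\<exists>m\<in>?S. \<forall>p\<in>?S. ?P m p \<longrightarrow> p = m"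
  proof (rule predicate_Zorn)
    show "partial_order_on ?S (relation_of ?P ?S)"
      by (rule partial_order_on_relation_ofI) auto
  next
    fix C assume C: "C \<in> Chains (relation_of ?P ?S)"
    have sub: "sublinear p" "p \<le> q" if "p \<in> C" for p
      using C that by (auto simp: Chains_def relation_of_def)
    have comp: "p \<le> p' \<or> p' \<le> p" if "p \<in> C" "p' \<in> C" for p p'
      using C that by (auto simp: Chains_def relation_of_def)
    show "\<exists>u\<in>?S. \<forall>p\<in>C. ?P p u"
    proof (cases "C = {}")
      case True
      then show ?thesis using q by auto
    next
      case False
      define u where "u x = (INF p\<in>C. p x)" for x
      have bound: "- q (- x) \<le> p x" if "p \<in> C" for p x
        using sublinear_ge_minus[OF sub(1)[OF that], of x] sub(2)[OF that]
        by (metis le_funD neg_le_iff_le order_trans)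
      have lower: "u x \<le> p x" if "p \<in> C" for p x
        unfolding u_def using that bound by (intro cINF_lower bdd_belowI2[where m="- q (- x)"]) auto
      have greatest: "m \<le> u x" if "\<And>p. p \<in> C \<Longrightarrow> m \<le> p x" for m x
        unfolding u_def using that False by (intro cINF_greatest) auto
      have "u (x + y) \<le> u x + u y" for x y
      proof -
        have "u (x + y) \<le> p x + p' y" if C: "p \<in> C" "p' \<in> C" for p p'
        proof -
          obtain p'' where p'': "p'' \<in> C" "p'' \<le> p" "p'' \<le> p'" using comp[OF C] C by blast
          then show ?thesis
            using lower[OF p''(1), of "x + y"] sublinear_add[OF sub(1)[OF p''(1)], of x y]
              le_funD[OF p''(2), of x] le_funD[OF p''(3), of y] by linarith
        qed
        then have "u (x + y) - p' y \<le> u x" if "p' \<in> C" for p'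
          using that by (intro greatest) (simp add: diff_le_eq)
        then have "u (x + y) - u x \<le> u y" by (intro greatest) (simp add: algebra_simps)
        then show ?thesis by simp
      qed
      moreover have "u (a *\<^sub>R x) = a * u x" if "0 \<le> a" for a x
      proof (cases "a = 0")
        case True
        obtain p where "p \<in> C" using False by blast
        then have "u 0 \<le> 0" using lower[of p 0] sublinear_zero[OF sub(1)[OF \<open>p \<in> C\<close>]] by simp
        moreover have "0 \<le> u 0"
          by (intro greatest) (metis order_refl sub(1) sublinear_zero)
        ultimately show ?thesis using True by simp
      next
        case False
        then have "0 < a" using that by simp
        have "u (a *\<^sub>R x) / a \<le> u x"
          using lower[of _ "a *\<^sub>R x"] sublinear_scale[OF sub(1) that] \<open>0 < a\<close>
          by (intro greatest) (simp add: field_simps)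
        moreover have "a * u x \<le> u (a *\<^sub>R x)"
        proof (rule greatest)
          fix p assume "p \<in> C"
          then show "a * u x \<le> p (a *\<^sub>R x)"
            using lower[of p x] sublinear_scale[OF sub(1) that, of p x] \<open>0 < a\<close> by simp
        qed
        ultimately show ?thesis using \<open>0 < a\<close> by (simp add: field_simps)
      qed
      ultimately have "sublinear u" by (auto simp: sublinear_def)
      moreover have "u \<le> p" if "p \<in> C" for p using lower[OF that] by (simp add: le_fun_def)
      ultimately show ?thesis using False sub(2) by (blast intro: order_trans)
    qed
  qed
  then show ?thesis using that by (blast intro: order_trans)
qed

text \<open>Flattening the norm along \<open>w\<close> before passing to a minimal functional forces the resulting linear
functional to be at least \<open>\<parallel>w\<parallel>\<close> at \<open>w\<close>, and being dominated by the norm keeps it bounded.\<close>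

theorem blinfun_separates_points:
  fixes u v :: "'a::real_normed_vector"
  assumes eq: "\<And>h :: 'a \<Rightarrow>\<^sub>L real. blinfun_apply h u = blinfun_apply h v"
  shows "u = v"
proof -
  define w where "w = u - v"
  have norm: "sublinear (norm :: 'a \<Rightarrow> real)"
    by (auto simp: sublinear_def norm_triangle_ineq)
  obtain p where p: "sublinear p" "p \<le> flatten norm w"
    and min: "\<And>p'. sublinear p' \<Longrightarrow> p' \<le> p \<Longrightarrow> p' = p"
    using ex_minimal_sublinear[OF sublinear_flatten[OF norm, of w]] by blast
  interpret linear p by (rule minimal_sublinear_linear[OF p(1) min])
  have le: "p x \<le> norm x" for x
    using p(2) flatten_le_self[OF norm, of w x] by (auto simp: le_fun_def intro: order_trans)
  have "norm (p x) \<le> norm x * 1" for x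
    using le[of x] le[of "- x"] by (simp add: neg abs_le_iff)
  then have "bounded_linear p"
    using linear_axioms by (intro bounded_linear_intro[where K=1]) (auto simp: add scale)
  then have "p w = 0"
    using eq[of "Blinfun p"] by (simp add: bounded_linear_Blinfun_apply w_def diff)
  moreover have "p (- w) \<le> - norm w"
    using p(2) flatten_uminus[OF norm, of w] by (auto simp: le_fun_def intro: order_trans)
  ultimately have "w = 0" by (simp add: neg)
  then show ?thesis by (simp add: w_def)
qed

section \<open>Minimisers of strongly convex functionals\<close>

text \<open>Lower semicontinuity is defined with punctured neighbourhoods; the point itself is restored here.\<close>

lemma lower_semicontinuous_eventually:
  assumes "lower_semicontinuous R" "c < R x"
  shows "\<forall>\<^sub>F u in nhds x. c < R u"
proof -
  have "c < Liminf (at x) R"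
    using assms by (auto simp: lower_semicontinuous_def intro: less_le_trans)
  then have "\<forall>\<^sub>F u in at x. c < R u" by (rule less_LiminfD)
  then show ?thesis using assms(2) by (simp add: eventually_nhds_conv_at)
qed

lemma lower_semicontinuousI:
  assumes "\<And>x c. c < R x \<Longrightarrow> \<forall>\<^sub>F u in nhds x. c < R u"
  shows "lower_semicontinuous R"
  unfolding lower_semicontinuous_def le_Liminf_iff
  using assms by (auto simp: eventually_nhds_conv_at)

lemma lower_semicontinuous_limit_le:
  assumes lsc: "lower_semicontinuous R" and lim: "u \<longlonglongrightarrow> x"
    and le: "\<And>n. R (u n) \<le> ereal (a n)" and a: "a \<longlonglongrightarrow> b"
  shows "R x \<le> ereal b"
proof (rule ccontr)
  assume "\<not> R x \<le> ereal b"
  then obtain c where c: "b < c" "ereal c < R x"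
    by (metis ereal_dense3 less_ereal.simps(1) not_le)
  have "\<forall>\<^sub>F n in sequentially. ereal c < R (u n)"
    using lower_semicontinuous_eventually[OF lsc c(2)] lim by (rule eventually_compose_filterlim)
  moreover have "\<forall>\<^sub>F n in sequentially. a n < c" using a c(1) by (rule order_tendstoD)
  ultimately have "\<forall>\<^sub>F n in sequentially. False"
  proof eventually_elim
    case (elim n)
    then show ?case using le[of n] by (meson ereal_less_eq(3) leD le_less_trans less_ereal.simps(1) order_trans less_imp_le)
  qed
  then show False by simp
qed

lemma lower_semicontinuous_add_continuous:
  assumes lsc: "lower_semicontinuous R" and g: "continuous_on UNIV g"
  shows "lower_semicontinuous (\<lambda>u. R u + ereal (g u))"
proof (rule lower_semicontinuousI)
  fix x c assume c: "c < R x + ereal (g x)"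
  show "\<forall>\<^sub>F u in nhds x. c < R u + ereal (g u)"
  proof (cases c)
    case (real c')
    have "ereal (c' - g x) < R x" using c real by (cases "R x") auto
    then obtain d where d: "ereal (c' - g x) < ereal d" "ereal d < R x"
      using ereal_dense2 by blast
    have "(g \<longlongrightarrow> g x) (nhds x)"
      using g by (simp add: continuous_on_def tendsto_nhds_iff)
    then have "\<forall>\<^sub>F u in nhds x. c' - d < g u" using d(1) by (intro order_tendstoD) auto
    with lower_semicontinuous_eventually[OF lsc d(2)] show ?thesis
    proof eventually_elim
      case (elim u)
      then show ?case using real by (cases "R u") auto
    qed
  next
    case MInf
    have "- \<infinity> < R x" using c MInf by (cases "R x") auto
    from lower_semicontinuous_eventually[OF lsc this] show ?thesis
    proof eventually_elim
      case (elim u)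
      then show ?case using MInf by (cases "R u") auto
    qed
  qed (use c in auto)
qed

lemma strongly_convex_add_convex:
  assumes R: "strongly_convex c R" and g: "convex_on UNIV g"
  shows "strongly_convex c (\<lambda>u. R u + ereal (g u))"
  unfolding strongly_convex_def
proof (intro allI impI)
  fix u v and \<gamma> :: real
  assume fin: "R u + ereal (g u) < \<infinity>" "R v + ereal (g v) < \<infinity>" and \<gamma>: "0 \<le> \<gamma>" "\<gamma> \<le> 1"
  have "R (\<gamma> *\<^sub>R u + (1 - \<gamma>) *\<^sub>R v) + ereal (c * \<gamma> * (1 - \<gamma>) * (norm (u - v))\<^sup>2)
      \<le> ereal \<gamma> * R u + ereal (1 - \<gamma>) * R v"
    using R fin \<gamma> by (auto simp: strongly_convex_def)
  moreover have "ereal (g (\<gamma> *\<^sub>R u + (1 - \<gamma>) *\<^sub>R v)) \<le> ereal (\<gamma> * g u + (1 - \<gamma>) * g v)"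
    using g \<gamma> by (auto simp: convex_on_def)
  ultimately have "R (\<gamma> *\<^sub>R u + (1 - \<gamma>) *\<^sub>R v) + ereal (c * \<gamma> * (1 - \<gamma>) * (norm (u - v))\<^sup>2)
      + ereal (g (\<gamma> *\<^sub>R u + (1 - \<gamma>) *\<^sub>R v))
      \<le> ereal \<gamma> * R u + ereal (1 - \<gamma>) * R v + ereal (\<gamma> * g u + (1 - \<gamma>) * g v)"
    by (rule add_mono)
  also have "\<dots> = ereal \<gamma> * (R u + ereal (g u)) + ereal (1 - \<gamma>) * (R v + ereal (g v))"
    using fin by (cases "R u"; cases "R v") (auto simp: algebra_simps)
  finally show "R (\<gamma> *\<^sub>R u + (1 - \<gamma>) *\<^sub>R v) + ereal (g (\<gamma> *\<^sub>R u + (1 - \<gamma>) *\<^sub>R v))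
      + ereal (c * \<gamma> * (1 - \<gamma>) * (norm (u - v))\<^sup>2)
      \<le> ereal \<gamma> * (R u + ereal (g u)) + ereal (1 - \<gamma>) * (R v + ereal (g v))"
    by (simp add: ac_simps)
qed

lemma strongly_convexD:
  assumes "strongly_convex c R" "R u = ereal a" "R v = ereal b" "0 \<le> \<gamma>" "\<gamma> \<le> 1"
  shows "R (\<gamma> *\<^sub>R u + (1 - \<gamma>) *\<^sub>R v)
    \<le> ereal (\<gamma> * a + (1 - \<gamma>) * b - c * \<gamma> * (1 - \<gamma>) * (norm (u - v))\<^sup>2)"
proof -
  let ?w = "\<gamma> *\<^sub>R u + (1 - \<gamma>) *\<^sub>R v"
  have "R u < \<infinity>" "R v < \<infinity>" using assms by auto
  then have "R ?w + ereal (c * \<gamma> * (1 - \<gamma>) * (norm (u - v))\<^sup>2) \<le> ereal \<gamma> * R u + ereal (1 - \<gamma>) * R v"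
    using assms unfolding strongly_convex_def by blast
  then show ?thesis using assms(2,3) by (cases "R ?w") auto
qed

text \<open>Perturbing by a continuous convex function preserves these hypotheses with the same \<open>c\<close> (see
\<open>add_continuous_convex\<close> below), so one existence theorem for minimisers serves both for evaluating the
conjugate, where the perturbation is \<open>- \<xi>\<close>, and for the penalty method, where it is a multiple of the
squared residual.\<close>

locale strongly_convex_functional =
  fixes R :: "'x::banach \<Rightarrow> ereal" and c :: real
  assumes proper: "proper_fun R"
    and lsc: "lower_semicontinuous R"
    and c_pos: "c > 0"
    and sconvex: "strongly_convex c R"
begin

lemma not_MInf [simp]: "R u \<noteq> - \<infinity>"
  using proper by (simp add: proper_fun_def)

lemma finiteE:
  assumes "R u < \<infinity>" obtains a where "R u = ereal a"
  using assms by (cases "R u") auto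

lemma ex_finite: obtains u a where "R u = ereal a"
  using proper finiteE by (metis proper_fun_def)

lemma add_continuous_convex:
  assumes "continuous_on UNIV g" "convex_on UNIV g"
  shows "strongly_convex_functional (\<lambda>u. R u + ereal (g u)) c"
proof
  have "\<exists>u. R u + ereal (g u) < \<infinity>" using ex_finite by (metis plus_ereal.simps(1) less_ereal.simps(4))
  moreover have "R u + ereal (g u) \<noteq> - \<infinity>" for u using not_MInf[of u] by (cases "R u") auto
  ultimately show "proper_fun (\<lambda>u. R u + ereal (g u))" by (auto simp: proper_fun_def)
  show "lower_semicontinuous (\<lambda>u. R u + ereal (g u))"
    by (rule lower_semicontinuous_add_continuous[OF lsc assms(1)])
  show "strongly_convex c (\<lambda>u. R u + ereal (g u))"
    by (rule strongly_convex_add_convex[OF sconvex assms(2)])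
qed (rule c_pos)

text \<open>Near a point \<open>x\<close> of finite value a lower bound is given by lower semicontinuity. A far point \<open>u\<close> is
joined to \<open>x\<close> by a segment; strong convexity, applied where the segment is at distance \<open>r'\<close> from \<open>x\<close>,
bounds \<open>R u\<close> below by a quadratic in the distance \<open>s\<close> with leading term \<open>c s\<^sup>2\<close>.\<close>

lemma bounded_below: obtains m where "\<And>u. ereal m \<le> R u"
proof -
  obtain x a where x: "R x = ereal a" by (rule ex_finite)
  have "\<forall>\<^sub>F u in nhds x. ereal (a - 1) < R u"
    using lsc x by (intro lower_semicontinuous_eventually) auto
  then obtain r where r: "r > 0" and near: "\<And>u. norm (u - x) < r \<Longrightarrow> ereal (a - 1) < R u"
    by (auto simp: eventually_nhds_metric dist_norm)
  define r' where "r' = r / 2"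
  have r': "r' > 0" and near': "\<And>u. norm (u - x) \<le> r' \<Longrightarrow> ereal (a - 1) < R u"
    using r near by (auto simp: r'_def)
  define k where "k = 1 / r' + c * r'"
  have "ereal (min (a - 1) (a - k\<^sup>2 / (4 * c))) \<le> R u" for u
  proof (cases "norm (u - x) \<le> r'")
    case True
    then show ?thesis using near'[of u] by (metis ereal_less_eq(3) less_imp_le min.cobounded1 order_trans)
  next
    case False
    define s where "s = norm (u - x)"
    have s: "r' < s" "0 < s" using False r' by (auto simp: s_def)
    show ?thesis
    proof (cases "R u")
      case (real b)
      \<comment> \<open>The point of the segment at distance exactly \<open>r'\<close> from \<open>x\<close>.\<close>
      define \<gamma> where "\<gamma> = r' / s"
      have \<gamma>: "0 < \<gamma>" "\<gamma> \<le> 1" using s r' by (auto simp: \<gamma>_def)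
      let ?w = "\<gamma> *\<^sub>R u + (1 - \<gamma>) *\<^sub>R x"
      have "?w - x = \<gamma> *\<^sub>R (u - x)" by (simp add: algebra_simps)
      then have "norm (?w - x) = \<gamma> * s" using \<gamma>(1) by (simp add: s_def)
      then have "norm (?w - x) \<le> r'" using s by (simp add: \<gamma>_def)
      then have "ereal (a - 1) < R ?w" by (rule near')
      also have "\<dots> \<le> ereal (\<gamma> * b + (1 - \<gamma>) * a - c * \<gamma> * (1 - \<gamma>) * s\<^sup>2)"
        unfolding s_def using \<gamma> real x by (intro strongly_convexD[OF sconvex]) auto
      finally have "a - 1 < \<gamma> * b + (1 - \<gamma>) * a - c * \<gamma> * (1 - \<gamma>) * s\<^sup>2" by simp
      then have "0 < \<gamma> * (b - a + 1 / \<gamma> - c * (1 - \<gamma>) * s\<^sup>2)"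
        using \<gamma>(1) by (simp add: algebra_simps)
      then have "0 < b - a + 1 / \<gamma> - c * (1 - \<gamma>) * s\<^sup>2"
        using \<gamma>(1) by (simp add: zero_less_mult_iff)
      also have "\<dots> = b - a + s / r' - c * s\<^sup>2 + c * r' * s"
        using s r' by (simp add: \<gamma>_def field_simps power2_eq_square)
      finally have "a + c * s\<^sup>2 - k * s < b" by (simp add: k_def algebra_simps)
      moreover have "c * s\<^sup>2 - k * s + k\<^sup>2 / (4 * c) = c * (s - k / (2 * c))\<^sup>2"
        using c_pos by (simp add: field_simps power2_eq_square)
      then have "0 \<le> c * s\<^sup>2 - k * s + k\<^sup>2 / (4 * c)" using c_pos by simp
      ultimately have "a - k\<^sup>2 / (4 * c) \<le> b" by linarith
      then show ?thesis by (simp add: real min.coboundedI2)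
    qed auto
  qed
  then show ?thesis by (rule that)
qed

text \<open>Strong convexity at midpoints makes a minimising sequence Cauchy. Comparing the minimum with values
on the segment from the minimiser \<open>x\<close> to \<open>u\<close>, close to \<open>x\<close>, gives the quadratic growth.\<close>

lemma ex_minimizer:
  obtains x m where "R x = ereal m" "\<And>u. ereal (m + c * (norm (u - x))\<^sup>2) \<le> R u"
proof -
  obtain l where l: "\<And>u. ereal l \<le> R u" using bounded_below by blast
  obtain u0 a0 where u0: "R u0 = ereal a0" by (rule ex_finite)
  have "ereal l \<le> (INF u. R u)" using l by (rule INF_greatest)
  moreover have "(INF u. R u) \<le> ereal a0" using u0 by (metis INF_lower UNIV_I)
  ultimately obtain m where m: "(INF u. R u) = ereal m" by (cases "INF u. R u") auto
  have m_le: "ereal m \<le> R u" for u using m by (metis INF_lower UNIV_I)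
  define d where "d n = inverse (real (Suc n))" for n
  have "\<exists>u. R u \<le> ereal (m + d n)" for n
  proof -
    have "(INF u. R u) < ereal (m + d n)" by (simp add: m d_def)
    then show ?thesis by (auto simp: INF_less_iff intro: less_imp_le)
  qed
  then obtain u where u: "\<And>n. R (u n) \<le> ereal (m + d n)" by metis
  have close: "c * (norm (u i - u j))\<^sup>2 \<le> 2 * (d i + d j)" for i j
  proof -
    obtain a where a: "R (u i) = ereal a" using u[of i] not_MInf[of "u i"] by (cases "R (u i)") auto
    obtain b where b: "R (u j) = ereal b" using u[of j] not_MInf[of "u j"] by (cases "R (u j)") auto
    have "ereal m \<le> ereal (1/2 * a + (1 - 1/2) * b - c * (1/2) * (1 - 1/2) * (norm (u i - u j))\<^sup>2)"
      by (rule order_trans[OF m_le strongly_convexD[OF sconvex a b]]) auto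
    then show ?thesis using u[of i] u[of j] a b by simp
  qed
  have "Cauchy u"
  proof (rule metric_CauchyI)
    fix e :: real assume e: "0 < e"
    then have "0 < c * e\<^sup>2 / 4" using c_pos by simp
    then obtain N where N: "d N < c * e\<^sup>2 / 4" unfolding d_def using reals_Archimedean by blast
    have "dist (u i) (u j) < e" if "N \<le> i" "N \<le> j" for i j
    proof -
      have "d i \<le> d N" "d j \<le> d N"
        using that by (auto simp: d_def intro!: le_imp_inverse_le)
      then have "2 * (d i + d j) \<le> 4 * d N" by simp
      with close[of i j] have "c * (norm (u i - u j))\<^sup>2 \<le> 4 * d N" by (rule order_trans)
      also have "\<dots> < c * e\<^sup>2" using N by simp
      finally have "c * (norm (u i - u j))\<^sup>2 < c * e\<^sup>2" .
      then have "(norm (u i - u j))\<^sup>2 < e\<^sup>2" using c_pos by simp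
      then show ?thesis using e by (simp add: dist_norm power2_less_imp_less)
    qed
    then show "\<exists>N. \<forall>i\<ge>N. \<forall>j\<ge>N. dist (u i) (u j) < e" by blast
  qed
  then obtain x where x: "u \<longlonglongrightarrow> x" by (auto simp: Cauchy_convergent_iff convergent_def)
  have "(\<lambda>n. m + d n) \<longlonglongrightarrow> m + 0"
    unfolding d_def by (intro tendsto_intros LIMSEQ_inverse_real_of_nat)
  then have "R x \<le> ereal m"
    using lower_semicontinuous_limit_le[OF lsc x u] by simp
  then have Rx: "R x = ereal m" using m_le by (simp add: antisym)
  have "ereal (m + c * (norm (v - x))\<^sup>2) \<le> R v" for v
  proof (cases "R v")
    case (real b)
    \<comment> \<open>The factor \<open>1 - \<gamma>\<close> disappears in the limit \<open>\<gamma> \<rightarrow> 0\<close>.\<close>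
    have "m + c * (1 - \<gamma>) * (norm (v - x))\<^sup>2 \<le> b" if \<gamma>: "0 < \<gamma>" "\<gamma> < 1" for \<gamma>
    proof -
      have "ereal m \<le> ereal (\<gamma> * b + (1 - \<gamma>) * m - c * \<gamma> * (1 - \<gamma>) * (norm (v - x))\<^sup>2)"
        using \<gamma> by (intro order_trans[OF m_le strongly_convexD[OF sconvex real Rx]]) auto
      then have "0 \<le> \<gamma> * (b - m - c * (1 - \<gamma>) * (norm (v - x))\<^sup>2)" by (simp add: algebra_simps)
      then show ?thesis using \<gamma> by (simp add: zero_le_mult_iff)
    qed
    then have "\<forall>\<^sub>F \<gamma> in at_right (0::real). m + c * (1 - \<gamma>) * (norm (v - x))\<^sup>2 \<le> b"
      using eventually_at_right_less[of 0] eventually_at_right[of 0 1]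
      by (auto simp: eventually_at_right_field intro!: exI[of _ 1])
    moreover have "((\<lambda>\<gamma>. m + c * (1 - \<gamma>) * (norm (v - x))\<^sup>2) \<longlongrightarrow> m + c * (1 - 0) * (norm (v - x))\<^sup>2)
        (at_right 0)"
      by (intro tendsto_intros)
    ultimately have "m + c * (1 - 0) * (norm (v - x))\<^sup>2 \<le> b"
      by (intro tendsto_upperbound) auto
    then show ?thesis by (simp add: real)
  qed auto
  with Rx show ?thesis by (rule that)
qed

end

section \<open>The conjugate and its gradient\<close>

lemma mult_minus_square_le:
  fixes h s c :: real
  assumes "c > 0"
  shows "h * s - c * s\<^sup>2 \<le> h\<^sup>2 / (4 * c)"
proof -
  have "h\<^sup>2 / (4 * c) - (h * s - c * s\<^sup>2) = c * (s - h / (2 * c))\<^sup>2"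
    using assms by (simp add: field_simps power2_eq_square)
  moreover have "0 \<le> c * (s - h / (2 * c))\<^sup>2" using assms by simp
  ultimately show ?thesis by linarith
qed

lemma norm_sq_convex_combination:
  fixes p q :: "'a::real_inner"
  shows "(norm (\<gamma> *\<^sub>R p + (1 - \<gamma>) *\<^sub>R q))\<^sup>2
    = \<gamma> * (norm p)\<^sup>2 + (1 - \<gamma>) * (norm q)\<^sup>2 - \<gamma> * (1 - \<gamma>) * (norm (p - q))\<^sup>2"
  unfolding power2_norm_eq_inner
  by (simp add: inner_simps inner_commute algebra_simps power2_eq_square)

lemma norm_sq_add_scaleR:
  fixes p h :: "'a::real_inner"
  shows "(norm (p + \<gamma> *\<^sub>R h))\<^sup>2 = (norm p)\<^sup>2 + 2 * \<gamma> * (p \<bullet> h) + \<gamma>\<^sup>2 * (norm h)\<^sup>2"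
  unfolding power2_norm_eq_inner
  by (simp add: inner_simps inner_commute algebra_simps power2_eq_square)

lemma convex_on_residual:
  fixes A :: "'x::real_normed_vector \<Rightarrow>\<^sub>L 'y::real_inner"
  assumes "0 \<le> k"
  shows "convex_on UNIV (\<lambda>u. k * (norm (blinfun_apply A u - y))\<^sup>2)"
proof (rule convex_onI)
  fix t :: real and u v assume t: "0 < t" "t < 1"
  have "blinfun_apply A ((1 - t) *\<^sub>R u + t *\<^sub>R v) - y
      = t *\<^sub>R (blinfun_apply A v - y) + (1 - t) *\<^sub>R (blinfun_apply A u - y)"
    by (simp add: blinfun.bilinear_simps algebra_simps)
  then have "(norm (blinfun_apply A ((1 - t) *\<^sub>R u + t *\<^sub>R v) - y))\<^sup>2
      \<le> t * (norm (blinfun_apply A v - y))\<^sup>2 + (1 - t) * (norm (blinfun_apply A u - y))\<^sup>2"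
    using t by (simp add: norm_sq_convex_combination)
  then have "k * (norm (blinfun_apply A ((1 - t) *\<^sub>R u + t *\<^sub>R v) - y))\<^sup>2
      \<le> k * (t * (norm (blinfun_apply A v - y))\<^sup>2 + (1 - t) * (norm (blinfun_apply A u - y))\<^sup>2)"
    using assms by (rule mult_left_mono)
  then show "k * (norm (blinfun_apply A ((1 - t) *\<^sub>R u + t *\<^sub>R v) - y))\<^sup>2
      \<le> (1 - t) * (k * (norm (blinfun_apply A u - y))\<^sup>2) + t * (k * (norm (blinfun_apply A v - y))\<^sup>2)"
    by (simp add: algebra_simps)
qed auto

text \<open>This makes \<open>gradient\<close>, a definite description, well defined wherever a gradient exists.\<close>

lemma gradient_at_unique:
  fixes x z :: "'a::real_normed_vector"
  assumes "gradient_at F \<xi> x" "gradient_at F \<xi> z"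
  shows "x = z"
proof (rule blinfun_separates_points)
  fix h :: "'a \<Rightarrow>\<^sub>L real"
  have "(\<lambda>h :: 'a \<Rightarrow>\<^sub>L real. blinfun_apply h x) = (\<lambda>h. blinfun_apply h z)"
    using assms unfolding gradient_at_def by (elim conjE) (rule has_derivative_unique)
  then show "blinfun_apply h x = blinfun_apply h z" by (rule fun_cong)
qed

context strongly_convex_functional
begin

lemma ex_maximizer:
  obtains x a where "R x = ereal a"
    "\<And>u. ereal (a + blinfun_apply \<xi> (u - x) + c * (norm (u - x))\<^sup>2) \<le> R u"
proof -
  have "convex_on UNIV (\<lambda>u. - blinfun_apply \<xi> u)"
    by (rule convex_onI) (auto simp: blinfun.bilinear_simps)
  then interpret P: strongly_convex_functional "\<lambda>u. R u + ereal (- blinfun_apply \<xi> u)" c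
    by (intro add_continuous_convex) (auto intro!: continuous_intros)
  obtain x m where x: "R x + ereal (- blinfun_apply \<xi> x) = ereal m"
    and growth: "\<And>u. ereal (m + c * (norm (u - x))\<^sup>2) \<le> R u + ereal (- blinfun_apply \<xi> u)"
    using P.ex_minimizer by blast
  from x obtain a where a: "R x = ereal a" "m = a - blinfun_apply \<xi> x" by (cases "R x") auto
  have "ereal (a + blinfun_apply \<xi> (u - x) + c * (norm (u - x))\<^sup>2) \<le> R u" for u
    using growth[of u] a(2) by (cases "R u") (auto simp: blinfun.bilinear_simps)
  with a(1) show ?thesis by (rule that)
qed

lemma conjugate_eq:
  assumes "R x = ereal a" "\<And>u. ereal (a + blinfun_apply \<xi> (u - x)) \<le> R u"
  shows "conjugate R \<xi> = ereal (blinfun_apply \<xi> x - a)"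
  unfolding conjugate_def
proof (rule SUP_eqI)
  fix u
  show "ereal (blinfun_apply \<xi> u) - R u \<le> ereal (blinfun_apply \<xi> x - a)"
    using assms(2)[of u] by (cases "R u") (auto simp: blinfun.bilinear_simps)
next
  fix m assume "\<And>u. u \<in> UNIV \<Longrightarrow> ereal (blinfun_apply \<xi> u) - R u \<le> m"
  from this[of x] show "ereal (blinfun_apply \<xi> x - a) \<le> m" using assms(1) by simp
qed

definition conj_real :: "('x \<Rightarrow>\<^sub>L real) \<Rightarrow> real" where
  "conj_real \<xi> = real_of_ereal (conjugate R \<xi>)"

lemma conj_real_maximizer:
  obtains x a where "R x = ereal a"
    "\<And>u. ereal (a + blinfun_apply \<xi> (u - x) + c * (norm (u - x))\<^sup>2) \<le> R u"
    "conjugate R \<xi> = ereal (conj_real \<xi>)" "conj_real \<xi> = blinfun_apply \<xi> x - a"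
proof -
  obtain x a where x: "R x = ereal a"
    and growth: "\<And>u. ereal (a + blinfun_apply \<xi> (u - x) + c * (norm (u - x))\<^sup>2) \<le> R u"
    using ex_maximizer by blast
  have "ereal (a + blinfun_apply \<xi> (u - x)) \<le> R u" for u
    using c_pos by (intro order_trans[OF _ growth]) simp
  from conjugate_eq[OF x this] show ?thesis
    using that[OF x growth] by (simp add: conj_real_def)
qed

lemma fenchel_young:
  assumes "R u = ereal a"
  shows "blinfun_apply \<xi> u - a \<le> conj_real \<xi>"
proof -
  obtain x b where "R x = ereal b"
    and growth: "\<And>u. ereal (b + blinfun_apply \<xi> (u - x) + c * (norm (u - x))\<^sup>2) \<le> R u"
    and "conjugate R \<xi> = ereal (conj_real \<xi>)" and val: "conj_real \<xi> = blinfun_apply \<xi> x - b"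
    using conj_real_maximizer[of \<xi>] by blast
  have "b + blinfun_apply \<xi> (u - x) + c * (norm (u - x))\<^sup>2 \<le> a"
    using growth[of u] assms by simp
  moreover have "0 \<le> c * (norm (u - x))\<^sup>2" using c_pos by simp
  ultimately show ?thesis using val by (simp add: blinfun.bilinear_simps)
qed

text \<open>If \<open>z\<close> maximises \<open>\<eta> - R\<close>, the growth of \<open>R\<close> around \<open>x\<close> leaves at most
\<open>\<parallel>\<eta> - \<xi>\<parallel> \<parallel>z - x\<parallel> - c \<parallel>z - x\<parallel>\<^sup>2\<close> above the affine function \<open>\<eta> x - a\<close>. Together with
\<open>fenchel_young\<close> this encloses the conjugate between an affine function and the same function plus a
quadratic, which is differentiability at \<open>\<xi>\<close>.\<close>

lemma conj_real_quadratic_upper_bound: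
  assumes x: "R x = ereal a"
    and growth: "\<And>u. ereal (a + blinfun_apply \<xi> (u - x) + c * (norm (u - x))\<^sup>2) \<le> R u"
  shows "conj_real \<eta> \<le> blinfun_apply \<eta> x - a + (norm (\<eta> - \<xi>))\<^sup>2 / (4 * c)"
proof -
  obtain z b where z: "R z = ereal b"
    and "\<And>u. ereal (b + blinfun_apply \<eta> (u - z) + c * (norm (u - z))\<^sup>2) \<le> R u"
    and "conjugate R \<eta> = ereal (conj_real \<eta>)" and val: "conj_real \<eta> = blinfun_apply \<eta> z - b"
    using conj_real_maximizer[of \<eta>] by blast
  have "a + blinfun_apply \<xi> (z - x) + c * (norm (z - x))\<^sup>2 \<le> b" using growth[of z] z by simp
  moreover have "blinfun_apply (\<eta> - \<xi>) (z - x) \<le> norm (\<eta> - \<xi>) * norm (z - x)"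
    using norm_blinfun[of "\<eta> - \<xi>" "z - x"] by simp
  ultimately show ?thesis
    using val mult_minus_square_le[OF c_pos, of "norm (\<eta> - \<xi>)" "norm (z - x)"]
    by (simp add: blinfun.bilinear_simps)
qed

lemma gradient_at_conjugate:
  assumes x: "R x = ereal a"
    and growth: "\<And>u. ereal (a + blinfun_apply \<xi> (u - x) + c * (norm (u - x))\<^sup>2) \<le> R u"
  shows "gradient_at (conjugate R) \<xi> x"
  unfolding gradient_at_def conj_real_def[symmetric]
proof
  have "conjugate R \<eta> = ereal (conj_real \<eta>)" for \<eta>
    by (rule conj_real_maximizer[of \<eta>])
  then show "\<forall>\<^sub>F \<eta> in nhds \<xi>. \<bar>conjugate R \<eta>\<bar> \<noteq> \<infinity>" by simp
  have "conj_real \<xi> \<le> blinfun_apply \<xi> x - a"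
    using conj_real_quadratic_upper_bound[OF x growth, of \<xi>] by simp
  then have val: "conj_real \<xi> = blinfun_apply \<xi> x - a"
    using fenchel_young[OF x] by (simp add: antisym)
  have "norm (conj_real (\<xi> + h) - conj_real \<xi> - blinfun_apply h x) / norm h \<le> norm h / (4 * c)" for h
  proof -
    have "norm (conj_real (\<xi> + h) - conj_real \<xi> - blinfun_apply h x) \<le> (norm h)\<^sup>2 / (4 * c)"
      using conj_real_quadratic_upper_bound[OF x growth, of "\<xi> + h"] fenchel_young[OF x, of "\<xi> + h"] val
      by (simp add: blinfun.bilinear_simps)
    then have "norm (conj_real (\<xi> + h) - conj_real \<xi> - blinfun_apply h x) / norm h
        \<le> (norm h)\<^sup>2 / (4 * c) / norm h"
      by (rule divide_right_mono) simp
    then show ?thesis by (cases "h = 0") (simp_all add: power2_eq_square)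
  qed
  then have bound: "\<forall>\<^sub>F h in at 0. norm (norm (conj_real (\<xi> + h) - conj_real \<xi> - blinfun_apply h x) / norm h)
      \<le> norm h / (4 * c)"
    by simp
  have "((\<lambda>h :: 'x \<Rightarrow>\<^sub>L real. norm h / (4 * c)) \<longlongrightarrow> norm (0 :: 'x \<Rightarrow>\<^sub>L real) / (4 * c)) (at 0)"
    using c_pos by (intro tendsto_intros) auto
  then have "((\<lambda>h :: 'x \<Rightarrow>\<^sub>L real. norm h / (4 * c)) \<longlongrightarrow> 0) (at 0)" by simp
  with bound have "((\<lambda>h. norm (conj_real (\<xi> + h) - conj_real \<xi> - blinfun_apply h x) / norm h) \<longlongrightarrow> 0) (at 0)"
    by (rule Lim_null_comparison)
  then show "(conj_real has_derivative (\<lambda>h. blinfun_apply h x)) (at \<xi>)"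
    by (simp add: has_derivative_at blinfun.bounded_linear_left)
qed

lemma gradient_conjugate:
  obtains a where "R (gradient (conjugate R) \<xi>) = ereal a"
    "\<And>u. ereal (a + blinfun_apply \<xi> (u - gradient (conjugate R) \<xi>)
        + c * (norm (u - gradient (conjugate R) \<xi>))\<^sup>2) \<le> R u"
    "conj_real \<xi> = blinfun_apply \<xi> (gradient (conjugate R) \<xi>) - a"
    "(conj_real has_derivative (\<lambda>h. blinfun_apply h (gradient (conjugate R) \<xi>))) (at \<xi>)"
proof -
  obtain x a where x: "R x = ereal a"
    and growth: "\<And>u. ereal (a + blinfun_apply \<xi> (u - x) + c * (norm (u - x))\<^sup>2) \<le> R u"
    and "conjugate R \<xi> = ereal (conj_real \<xi>)" and val: "conj_real \<xi> = blinfun_apply \<xi> x - a"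
    using conj_real_maximizer[of \<xi>] by blast
  have grad: "gradient_at (conjugate R) \<xi> x" by (rule gradient_at_conjugate[OF x growth])
  have eq: "gradient (conjugate R) \<xi> = x"
    unfolding gradient_def by (rule the_equality) (use grad gradient_at_unique in blast)+
  show ?thesis
    by (rule that[of a]) (use x growth val grad in \<open>auto simp: eq gradient_at_def conj_real_def[abs_def]\<close>)
qed

text \<open>Strong duality for the constraint \<open>A u = y\<close>, by penalisation. Let \<open>u\<^sub>n\<close> minimise
\<open>R u + (n/2) \<parallel>A u - y\<parallel>\<^sup>2\<close>, with minimal value \<open>m\<^sub>n\<close>. The values \<open>m\<^sub>n\<close> increase and stay below \<open>R x\<^sup>\<dagger>\<close>; by
quadratic growth \<open>c \<parallel>u\<^sub>j - u\<^sub>k\<parallel>\<^sup>2 \<le> m\<^sub>j - m\<^sub>k\<close> for \<open>k \<le> j\<close>, so \<open>u\<^sub>n\<close> converges strongly, its limit is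
feasible, and lower semicontinuity gives \<open>R u\<^sub>n > R x\<^sup>\<dagger> - \<epsilon>\<close> for some \<open>n\<close>. The first-order condition at
\<open>u\<^sub>n\<close> says that \<open>\<mu> = n (y - A u\<^sub>n)\<close> is a multiplier for which \<open>u\<^sub>n\<close> minimises the Lagrangian, whose
value at \<open>u\<^sub>n\<close> is at least \<open>R u\<^sub>n\<close>.\<close>

theorem approximate_lagrange_multiplier:
  fixes A :: "'x \<Rightarrow>\<^sub>L 'y::real_inner"
  assumes sol: "minimizing_solution R A y xdag" and a: "R xdag = ereal a" and \<epsilon>: "0 < \<epsilon>"
  obtains \<mu> where "\<And>u. ereal (a - \<epsilon>) \<le> R u + ereal (\<mu> \<bullet> (y - blinfun_apply A u))"
proof -
  define q where "q u = (norm (blinfun_apply A u - y))\<^sup>2" for u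
  have q_nonneg: "0 \<le> q u" for u by (simp add: q_def)
  have q_xdag: "q xdag = 0" using sol by (simp add: q_def minimizing_solution_def)
  have "\<exists>u b. R u = ereal b \<and>
      (\<forall>w. ereal (b + real n / 2 * q u + c * (norm (w - u))\<^sup>2) \<le> R w + ereal (real n / 2 * q w))" for n
  proof -
    interpret P: strongly_convex_functional "\<lambda>u. R u + ereal (real n / 2 * q u)" c
      unfolding q_def by (intro add_continuous_convex convex_on_residual) (auto intro!: continuous_intros)
    obtain u m where um: "R u + ereal (real n / 2 * q u) = ereal m"
      "\<And>w. ereal (m + c * (norm (w - u))\<^sup>2) \<le> R w + ereal (real n / 2 * q w)"
      using P.ex_minimizer by blast
    from um(1) obtain b where "R u = ereal b" "m = b + real n / 2 * q u" by (cases "R u") auto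
    with um(2) show ?thesis by blast
  qed
  then obtain u b where Ru: "\<And>n. R (u n) = ereal (b n)"
    and growth: "\<And>n w. ereal (b n + real n / 2 * q (u n) + c * (norm (w - u n))\<^sup>2)
        \<le> R w + ereal (real n / 2 * q w)"
    by metis
  define m where "m n = b n + real n / 2 * q (u n)" for n
  have m_le: "m n \<le> a" for n
  proof -
    have "m n + c * (norm (xdag - u n))\<^sup>2 \<le> a"
      using growth[of n xdag] by (simp add: m_def a q_xdag)
    moreover have "0 \<le> c * (norm (xdag - u n))\<^sup>2" using c_pos by simp
    ultimately show ?thesis by linarith
  qed
  have step: "c * (norm (u j - u k))\<^sup>2 \<le> m j - m k" if "k \<le> j" for j k
  proof -
    have "m k + c * (norm (u j - u k))\<^sup>2 \<le> b j + real k / 2 * q (u j)"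
      using growth[of k "u j"] by (simp add: m_def Ru)
    also have "\<dots> \<le> m j" using that q_nonneg[of "u j"] by (simp add: m_def mult_right_mono)
    finally show ?thesis by simp
  qed
  have "incseq m"
  proof (rule monoI)
    fix k j :: nat assume "k \<le> j"
    moreover have "0 \<le> c * (norm (u j - u k))\<^sup>2" using c_pos by simp
    ultimately show "m k \<le> m j" using step[of k j] by linarith
  qed
  then have "Cauchy m" using m_le
    by (metis LIMSEQ_imp_Cauchy incseq_convergent)
  have "Cauchy u"
  proof (rule metric_CauchyI)
    fix e :: real assume e: "0 < e"
    then have "0 < c * e\<^sup>2" using c_pos by simp
    then obtain N where N: "\<And>j k. N \<le> j \<Longrightarrow> N \<le> k \<Longrightarrow> dist (m j) (m k) < c * e\<^sup>2"
      using \<open>Cauchy m\<close> unfolding Cauchy_def by blast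
    have *: "dist (u j) (u k) < e" if "N \<le> k" "k \<le> j" for j k
    proof -
      have "c * (norm (u j - u k))\<^sup>2 < c * e\<^sup>2"
        using step[OF that(2)] N[of j k] that by (simp add: dist_real_def)
      then have "(norm (u j - u k))\<^sup>2 < e\<^sup>2" using c_pos by simp
      then show ?thesis using e by (simp add: dist_norm power2_less_imp_less)
    qed
    have "dist (u j) (u k) < e" if "N \<le> j" "N \<le> k" for j k
      using *[of j k] *[of k j] that by (cases "k \<le> j") (auto simp: dist_commute)
    then show "\<exists>N. \<forall>j\<ge>N. \<forall>k\<ge>N. dist (u j) (u k) < e" by blast
  qed
  then obtain v where v: "u \<longlonglongrightarrow> v" by (auto simp: Cauchy_convergent_iff convergent_def)
  obtain l where l: "\<And>u. ereal l \<le> R u" using bounded_below by blast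
  have "blinfun_apply A v = y"
  proof -
    have "(\<lambda>n. q (u n)) \<longlonglongrightarrow> q v"
      unfolding q_def by (intro tendsto_intros v)
    moreover have "(\<lambda>n. q (u n)) \<longlonglongrightarrow> 0"
    proof (rule tendsto_sandwich[OF _ _ tendsto_const])
      show "\<forall>\<^sub>F n in sequentially. q (u n) \<le> 2 * (a - l) / real n"
        using eventually_gt_at_top[of 0]
      proof eventually_elim
        case (elim n)
        then show ?case using m_le[of n] l[of "u n"] Ru[of n] by (simp add: m_def field_simps)
      qed
      show "(\<lambda>n. 2 * (a - l) / real n) \<longlonglongrightarrow> 0" by (rule lim_const_over_n)
    qed (simp add: q_nonneg)
    ultimately have "q v = 0" by (rule LIMSEQ_unique)
    then show ?thesis by (simp add: q_def)
  qed
  then have "ereal a \<le> R v" using sol by (simp add: minimizing_solution_def a)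
  then have "ereal (a - \<epsilon>) < R v" using \<epsilon> by (cases "R v") auto
  then have "\<forall>\<^sub>F n in sequentially. ereal (a - \<epsilon>) < R (u n)"
    by (rule eventually_compose_filterlim[OF lower_semicontinuous_eventually[OF lsc] v])
  then obtain n where n: "a - \<epsilon> < b n" by (auto simp: Ru eventually_sequentially)
  define \<mu> where "\<mu> = real n *\<^sub>R (y - blinfun_apply A (u n))"
  have "ereal (a - \<epsilon>) \<le> R w + ereal (\<mu> \<bullet> (y - blinfun_apply A w))" for w
  proof (cases "R w")
    case (real d)
    define h where "h = blinfun_apply A (w - u n)"
    define s where "s = (blinfun_apply A (u n) - y) \<bullet> h"
    have \<mu>h: "\<mu> \<bullet> h = - real n * s"
      by (simp add: \<mu>_def s_def inner_simps algebra_simps)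
    \<comment> \<open>First-order condition: compare \<open>u n\<close> with nearby points of the segment towards \<open>w\<close>.\<close>
    have ineq: "0 \<le> d - b n - \<mu> \<bullet> h + \<gamma> * (real n / 2 * (norm h)\<^sup>2)" if \<gamma>: "0 < \<gamma>" "\<gamma> < 1" for \<gamma>
    proof -
      let ?z = "\<gamma> *\<^sub>R w + (1 - \<gamma>) *\<^sub>R u n"
      have "R ?z \<le> ereal (\<gamma> * d + (1 - \<gamma>) * b n - c * \<gamma> * (1 - \<gamma>) * (norm (w - u n))\<^sup>2)"
        using \<gamma> by (intro strongly_convexD[OF sconvex real Ru]) auto
      also have "\<dots> \<le> ereal (\<gamma> * d + (1 - \<gamma>) * b n)" using \<gamma> c_pos by simp
      finally have R: "R ?z \<le> ereal (\<gamma> * d + (1 - \<gamma>) * b n)" .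
      have "m n \<le> m n + c * (norm (?z - u n))\<^sup>2" using c_pos by simp
      then have "ereal (m n) \<le> R ?z + ereal (real n / 2 * q ?z)"
        using growth[of n ?z] unfolding m_def by (meson ereal_less_eq(3) order_trans)
      also have "\<dots> \<le> ereal (\<gamma> * d + (1 - \<gamma>) * b n) + ereal (real n / 2 * q ?z)"
        using R by (rule add_right_mono)
      finally have "m n \<le> \<gamma> * d + (1 - \<gamma>) * b n + real n / 2 * q ?z" by simp
      moreover have "blinfun_apply A ?z - y = (blinfun_apply A (u n) - y) + \<gamma> *\<^sub>R h"
        by (simp add: h_def blinfun.bilinear_simps algebra_simps)
      then have "q ?z = q (u n) + 2 * \<gamma> * s + \<gamma>\<^sup>2 * (norm h)\<^sup>2"
        unfolding q_def s_def by (simp only: norm_sq_add_scaleR)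
      ultimately have "m n \<le> \<gamma> * d + (1 - \<gamma>) * b n + real n / 2 *
          (q (u n) + 2 * \<gamma> * s + \<gamma>\<^sup>2 * (norm h)\<^sup>2)" by simp
      then have "0 \<le> \<gamma> * (d - b n - \<mu> \<bullet> h + \<gamma> * (real n / 2 * (norm h)\<^sup>2))"
        by (simp add: m_def \<mu>h algebra_simps power2_eq_square)
      then show ?thesis using \<gamma>(1) by (simp add: zero_le_mult_iff)
    qed
    have "0 \<le> d - b n - \<mu> \<bullet> h + 0 * (real n / 2 * (norm h)\<^sup>2)"
    proof (rule tendsto_lowerbound)
      show "((\<lambda>\<gamma>. d - b n - \<mu> \<bullet> h + \<gamma> * (real n / 2 * (norm h)\<^sup>2)) \<longlongrightarrow>
          d - b n - \<mu> \<bullet> h + 0 * (real n / 2 * (norm h)\<^sup>2)) (at_right 0)" by (intro tendsto_intros)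
      show "\<forall>\<^sub>F \<gamma> in at_right 0. 0 \<le> d - b n - \<mu> \<bullet> h + \<gamma> * (real n / 2 * (norm h)\<^sup>2)"
        using ineq by (auto simp: eventually_at_right_field intro!: exI[of _ 1])
    qed simp
    then have "b n \<le> d - \<mu> \<bullet> h" by simp
    moreover have "\<mu> \<bullet> (y - blinfun_apply A w) = real n * q (u n) - \<mu> \<bullet> h"
    proof -
      have "q (u n) = (y - blinfun_apply A (u n)) \<bullet> (y - blinfun_apply A (u n))"
        by (simp add: q_def norm_minus_commute flip: power2_norm_eq_inner)
      then have \<mu>q: "\<mu> \<bullet> (y - blinfun_apply A (u n)) = real n * q (u n)" by (simp add: \<mu>_def)
      have "y - blinfun_apply A w = (y - blinfun_apply A (u n)) - h"
        by (simp add: h_def blinfun.diff_right)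
      then have "\<mu> \<bullet> (y - blinfun_apply A w) = \<mu> \<bullet> ((y - blinfun_apply A (u n)) - h)" by (rule arg_cong)
      also have "\<dots> = \<mu> \<bullet> (y - blinfun_apply A (u n)) - \<mu> \<bullet> h" by (rule inner_diff_right)
      finally show ?thesis unfolding \<mu>q .
    qed
    moreover have "0 \<le> real n * q (u n)" by (simp add: q_nonneg)
    ultimately have "a - \<epsilon> \<le> d + \<mu> \<bullet> (y - blinfun_apply A w)" using n by linarith
    then show ?thesis by (simp add: real)
  next
    case PInf
    then show ?thesis by simp
  next
    case MInf
    then show ?thesis using not_MInf by blast
  qed
  then show ?thesis using that[of \<mu>] by simp
qed

end

section \<open>Gradient flows of convex functions\<close>

text \<open>Two solutions of a monotone flow do not move apart. Applied to \<open>l\<close> and its own time shift by \<open>h\<close>, this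
says that \<open>\<parallel>l (t + h) - l t\<parallel>\<close> is nonincreasing in \<open>t\<close>; dividing by \<open>h\<close> and letting \<open>h \<rightarrow> 0\<close> gives the
speed, although \<open>g\<close> itself may fail to be differentiable.\<close>

lemma gradient_flow_speed_antimono:
  fixes g :: "'y::real_inner \<Rightarrow> 'y"
  assumes mono: "\<And>a b. 0 \<le> (g a - g b) \<bullet> (a - b)"
    and flow: "\<And>t. 0 < t \<Longrightarrow> (l has_vector_derivative - g (l t)) (at t)"
    and st: "0 < s" "s \<le> t"
  shows "norm (g (l t)) \<le> norm (g (l s))"
proof -
  have contract: "norm (l (t + h) - l t) \<le> norm (l (s + h) - l s)" if h: "0 < h" for h
  proof -
    define \<phi> where "\<phi> \<tau> = (l (\<tau> + h) - l \<tau>) \<bullet> (l (\<tau> + h) - l \<tau>)" for \<tau>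
    have "\<phi> t \<le> \<phi> s"
    proof (rule DERIV_nonpos_imp_nonincreasing[OF st(2)])
      fix \<tau> assume "s \<le> \<tau>" "\<tau> \<le> t"
      then have \<tau>: "0 < \<tau>" "0 < \<tau> + h" using st h by auto
      define v where "v = - (g (l (\<tau> + h)) - g (l \<tau>))"
      have "((\<lambda>\<tau>. \<tau> + h) has_vector_derivative 1) (at \<tau>)"
        by (auto simp: has_vector_derivative_def intro!: derivative_eq_intros)
      from vector_diff_chain_at[OF this flow[OF \<tau>(2)]]
      have "((\<lambda>\<tau>. l (\<tau> + h)) has_vector_derivative - g (l (\<tau> + h))) (at \<tau>)"
        by (simp add: o_def)
      then have "((\<lambda>\<tau>. l (\<tau> + h) - l \<tau>) has_vector_derivative v) (at \<tau>)"
        using flow[OF \<tau>(1)] unfolding v_def by (auto intro!: derivative_eq_intros)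
      then have D: "((\<lambda>\<tau>. l (\<tau> + h) - l \<tau>) has_derivative (\<lambda>d. d *\<^sub>R v)) (at \<tau>)"
        by (simp add: has_vector_derivative_def)
      have "(\<phi> has_real_derivative 2 * ((l (\<tau> + h) - l \<tau>) \<bullet> v)) (at \<tau>)"
        unfolding has_field_derivative_def \<phi>_def[abs_def]
        by (rule has_derivative_eq_rhs[OF has_derivative_inner[OF D D]])
          (auto simp: inner_commute algebra_simps)
      moreover have "2 * ((l (\<tau> + h) - l \<tau>) \<bullet> v) \<le> 0"
        using mono[of "l (\<tau> + h)" "l \<tau>"] by (simp add: v_def inner_simps inner_commute)
      ultimately show "\<exists>d. (\<phi> has_real_derivative d) (at \<tau>) \<and> d \<le> 0" by blast
    qed
    then show ?thesis by (simp add: \<phi>_def norm_le)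
  qed
  have quotient: "((\<lambda>h. norm (l (\<tau> + h) - l \<tau>) / h) \<longlongrightarrow> norm (g (l \<tau>))) (at_right 0)" if "0 < \<tau>" for \<tau>
  proof -
    have "((\<lambda>h. norm (l (\<tau> + h) - l \<tau> - h *\<^sub>R (- g (l \<tau>))) / norm h) \<longlongrightarrow> 0) (at 0)"
      using flow[OF that] by (simp add: has_vector_derivative_def has_derivative_at)
    then have lim: "((\<lambda>h. norm (l (\<tau> + h) - l \<tau> - h *\<^sub>R (- g (l \<tau>))) / norm h) \<longlongrightarrow> 0) (at_right 0)"
      by (rule tendsto_mono[rotated]) (simp add: at_le)
    have bound: "norm (norm (l (\<tau> + h) - l \<tau>) / h - norm (g (l \<tau>)))
        \<le> norm (l (\<tau> + h) - l \<tau> - h *\<^sub>R (- g (l \<tau>))) / norm h" if "0 < h" for h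
    proof -
      have "norm (norm (l (\<tau> + h) - l \<tau>) / h - norm (g (l \<tau>)))
          = \<bar>norm (l (\<tau> + h) - l \<tau>) - norm (h *\<^sub>R (- g (l \<tau>)))\<bar> / h"
        using that by (simp add: field_simps)
      also have "\<dots> \<le> norm (l (\<tau> + h) - l \<tau> - h *\<^sub>R (- g (l \<tau>))) / h"
        using that by (intro divide_right_mono norm_triangle_ineq3) simp
      finally show ?thesis using that by simp
    qed
    have "\<forall>\<^sub>F h in at_right 0. norm (norm (l (\<tau> + h) - l \<tau>) / h - norm (g (l \<tau>)))
        \<le> norm (l (\<tau> + h) - l \<tau> - h *\<^sub>R (- g (l \<tau>))) / norm h"
      using eventually_at_right_less[of 0] by eventually_elim (rule bound)
    from Lim_null_comparison[OF this lim]
    show ?thesis by (simp add: LIM_zero_iff)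
  qed
  show ?thesis
  proof (rule tendsto_le[OF _ quotient quotient])
    show "\<forall>\<^sub>F h in at_right 0. norm (l (t + h) - l t) / h \<le> norm (l (s + h) - l s) / h"
      using contract by (auto simp: eventually_at_right_field divide_right_mono intro!: exI[of _ 1])
  qed (use st in auto)
qed

text \<open>The left-hand side is the value at \<open>T\<close> of a Lyapunov function whose last term carries the final speed
as a constant. Its derivative at \<open>\<tau> < T\<close> is the convexity defect of \<open>F\<close> between \<open>l \<tau>\<close> and \<open>\<mu>\<close>, which is
nonpositive, plus \<open>\<tau> (\<parallel>g (l T)\<parallel>\<^sup>2 - \<parallel>g (l \<tau>)\<parallel>\<^sup>2)\<close>, which is nonpositive because the speed
decreases.\<close>

theorem gradient_flow_estimate:
  fixes F :: "'y::real_inner \<Rightarrow> real" and g :: "'y \<Rightarrow> 'y"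
  assumes grad: "\<And>a. (F has_derivative (\<lambda>h. g a \<bullet> h)) (at a)"
    and convex: "\<And>a b. F a + g a \<bullet> (b - a) \<le> F b"
    and cont: "continuous_on {0..} l"
    and flow: "\<And>t. 0 < t \<Longrightarrow> (l has_vector_derivative - g (l t)) (at t)"
    and T: "0 < T"
  shows "T * (F (l T) - F \<mu>) + (norm (l T - \<mu>))\<^sup>2 / 2 + T\<^sup>2 * (norm (g (l T)))\<^sup>2 / 2
    \<le> (norm (l 0 - \<mu>))\<^sup>2 / 2"
proof -
  have mono: "0 \<le> (g a - g b) \<bullet> (a - b)" for a b
    using convex[of a b] convex[of b a] by (simp add: inner_simps)
  define G where "G = (norm (g (l T)))\<^sup>2"
  define V where "V \<tau> = \<tau> * (F (l \<tau>) - F \<mu>) + ((l \<tau> - \<mu>) \<bullet> (l \<tau> - \<mu>)) / 2 + \<tau>\<^sup>2 * G / 2" for \<tau>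
  have "V T \<le> V 0"
  proof (rule DERIV_nonpos_imp_decreasing_open[where f=V])
    show "0 \<le> T" using T by simp
    have "continuous_on UNIV F"
      using grad by (meson continuous_at_imp_continuous_on has_derivative_continuous)
    then have "continuous_on {0..T} (\<lambda>\<tau>. F (l \<tau>))"
      by (rule continuous_on_compose2) (auto intro: continuous_on_subset[OF cont])
    then show "continuous_on {0..T} V"
      unfolding V_def[abs_def] by (intro continuous_intros continuous_on_subset[OF cont]) auto
  next
    fix \<tau> assume \<tau>: "0 < \<tau>" "\<tau> < T"
    define k where "k = g (l \<tau>)"
    have D: "(l has_derivative (\<lambda>d. d *\<^sub>R (- k))) (at \<tau>)"
      using flow[OF \<tau>(1)] by (simp add: has_vector_derivative_def k_def)
    have "((\<lambda>\<tau>. F (l \<tau>)) has_derivative (\<lambda>d. k \<bullet> (d *\<^sub>R (- k)))) (at \<tau>)"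
      unfolding k_def by (rule has_derivative_compose[OF D[unfolded k_def] grad])
    then have DF: "((\<lambda>\<tau>. F (l \<tau>)) has_real_derivative - (k \<bullet> k)) (at \<tau>)"
      unfolding has_field_derivative_def by (rule has_derivative_eq_rhs) auto
    have D': "((\<lambda>\<tau>. l \<tau> - \<mu>) has_derivative (\<lambda>d. d *\<^sub>R (- k))) (at \<tau>)"
      using has_derivative_diff[OF D has_derivative_const[of \<mu>]] by simp
    have DN: "((\<lambda>\<tau>. (l \<tau> - \<mu>) \<bullet> (l \<tau> - \<mu>)) has_real_derivative - 2 * (k \<bullet> (l \<tau> - \<mu>))) (at \<tau>)"
      unfolding has_field_derivative_def
      by (rule has_derivative_eq_rhs[OF has_derivative_inner[OF D' D']])
        (auto simp: inner_commute algebra_simps)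
    have DV: "(V has_real_derivative
        (F (l \<tau>) - F \<mu> - \<tau> * (k \<bullet> k) - k \<bullet> (l \<tau> - \<mu>) + \<tau> * G)) (at \<tau>)"
      unfolding V_def[abs_def]
      by (rule DERIV_cong[OF DERIV_add[OF DERIV_add[OF DERIV_mult[OF DERIV_ident
              DERIV_diff[OF DF DERIV_const]] DERIV_cdivide[OF DN]] DERIV_cdivide[OF DERIV_cmult_right[OF DERIV_pow]]]])
        (simp add: field_simps)
    have "F (l \<tau>) - F \<mu> - k \<bullet> (l \<tau> - \<mu>) \<le> 0"
      using convex[of "l \<tau>" \<mu>] by (simp add: k_def inner_simps)
    moreover have "G \<le> k \<bullet> k"
      using gradient_flow_speed_antimono[where g=g and l=l, OF mono flow, of \<tau> T] \<tau>
      by (simp add: G_def k_def flip: power2_norm_eq_inner)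
    then have "\<tau> * G \<le> \<tau> * (k \<bullet> k)" using \<tau> by simp
    ultimately have "F (l \<tau>) - F \<mu> - \<tau> * (k \<bullet> k) - k \<bullet> (l \<tau> - \<mu>) + \<tau> * G \<le> 0" by simp
    with DV show "\<exists>y. (V has_real_derivative y) (at \<tau>) \<and> y \<le> 0" by blast
  qed
  then show ?thesis by (simp add: V_def G_def power2_norm_eq_inner)
qed

section \<open>Convergence of the dual gradient flow\<close>

lemma bounded_linear_dual_adjoint: "bounded_linear (dual_adjoint A)"
  unfolding dual_adjoint_def[abs_def]
  by (rule bounded_linear_compose[OF bounded_bilinear.bounded_linear_left[OF
        bounded_bilinear_blinfun_compose] bounded_linear_blinfun_inner_right])

text \<open>The real arithmetic of the error estimate. Here \<open>d\<close> stands for the Bregman distance, \<open>e\<close> for the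
duality gap of \<open>\<mu>\<close>, \<open>N\<close>, \<open>M\<close>, \<open>G\<close> for the norms of \<open>\<lambda> - \<mu>\<close>, \<open>\<mu>\<close> and the residual. Young's inequality
absorbs the noise term \<open>t \<delta> N\<close> into half of \<open>N\<^sup>2/2\<close>; the rest bounds each of \<open>N\<^sup>2\<close>, \<open>t\<^sup>2 G\<^sup>2\<close>,
\<open>M\<^sup>2 + t\<^sup>2 \<delta>\<^sup>2\<close> by a multiple of \<open>t E\<close>.\<close>

lemma error_terms_bound:
  fixes d e \<delta> t N G M E :: real
  assumes t: "0 < t" and nonneg: "0 \<le> d" "0 \<le> e" "0 \<le> \<delta>" "0 \<le> N" "0 \<le> G" "0 \<le> M"
    and energy: "t * (d - e - \<delta> * N) + N\<^sup>2 / 2 + t\<^sup>2 * G\<^sup>2 / 2 \<le> M\<^sup>2 / 2"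
    and E: "E = M\<^sup>2 / (2 * t) + e + \<delta>\<^sup>2 * t"
  shows "d \<le> E" "(N + M) * (\<delta> + G) \<le> 8 * E"
proof -
  have tE: "t * E = M\<^sup>2 / 2 + t * e + t\<^sup>2 * \<delta>\<^sup>2"
    using t by (simp add: E field_simps power2_eq_square)
  have "0 \<le> (N / 2 - t * \<delta>)\<^sup>2" by simp
  also have "\<dots> = N\<^sup>2 / 4 - t * \<delta> * N + t\<^sup>2 * \<delta>\<^sup>2"
    by (simp add: power2_eq_square field_simps)
  finally have young: "t * \<delta> * N \<le> N\<^sup>2 / 4 + t\<^sup>2 * \<delta>\<^sup>2" by simp
  have "t * (d - e - \<delta> * N) = t * d - t * e - t * \<delta> * N" by (simp add: algebra_simps)
  with energy young have main: "t * d + N\<^sup>2 / 4 + t\<^sup>2 * G\<^sup>2 / 2 \<le> t * E"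
    unfolding tE by linarith
  have pos: "0 \<le> t * d" "0 \<le> t * e" "0 \<le> N\<^sup>2" "0 \<le> t\<^sup>2 * G\<^sup>2" "0 \<le> M\<^sup>2" "0 \<le> t\<^sup>2 * \<delta>\<^sup>2"
    using t nonneg by auto
  have "t * d \<le> t * E" using main pos by linarith
  then show "d \<le> E" using t by simp
  have "0 \<le> ((N + M) - t * (\<delta> + G))\<^sup>2 + (N - M)\<^sup>2 + (t * \<delta> - t * G)\<^sup>2" by simp
  also have "\<dots> = 2 * (N\<^sup>2 + M\<^sup>2 + t\<^sup>2 * \<delta>\<^sup>2 + t\<^sup>2 * G\<^sup>2) - 2 * (t * ((N + M) * (\<delta> + G)))"
    by (simp add: power2_eq_square algebra_simps)
  finally have "t * ((N + M) * (\<delta> + G)) \<le> N\<^sup>2 + M\<^sup>2 + t\<^sup>2 * \<delta>\<^sup>2 + t\<^sup>2 * G\<^sup>2" by simp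
  also have "\<dots> \<le> 8 * (t * E)"
  proof -
    have "N\<^sup>2 \<le> 4 * (t * E)" "t\<^sup>2 * G\<^sup>2 \<le> 2 * (t * E)" "M\<^sup>2 + t\<^sup>2 * \<delta>\<^sup>2 \<le> 2 * (t * E)"
      using main pos tE by linarith+
    then show ?thesis by linarith
  qed
  finally have "t * ((N + M) * (\<delta> + G)) \<le> t * (8 * E)" by simp
  then show "(N + M) * (\<delta> + G) \<le> 8 * E" using t by simp
qed

context strongly_convex_functional
begin

text \<open>A non-asymptotic form of the convergence theorem, for one noise level, one time and one approximate
multiplier \<open>\<mu>\<close> with duality gap \<open>e\<close>. The difference of the \<open>R\<close>-values is
\<open>b - a = - d - l t \<bullet> (y - A (x t))\<close>, and the pairing is at most \<open>8 E\<close>.\<close>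

theorem dual_gradient_flow_error_estimate:
  fixes A :: "'x \<Rightarrow>\<^sub>L 'y::real_inner"
  assumes Axdag: "blinfun_apply A xdag = y" and a: "R xdag = ereal a"
    and noise: "norm (yd - y) \<le> \<delta>"
    and flow: "dual_gradient_flow R A yd x l" and l0: "l 0 = 0" and t: "0 < t"
    and multiplier: "\<And>u. ereal (a - e) \<le> R u + ereal (\<mu> \<bullet> (y - blinfun_apply A u))"
    and E: "E = (norm \<mu>)\<^sup>2 / (2 * t) + e + \<delta>\<^sup>2 * t"
  obtains b d where "R (x t) = ereal b"
    and "bregman R (dual_adjoint A (l t)) xdag (x t) = ereal d"
    and "c * (norm (x t - xdag))\<^sup>2 \<le> d" and "d \<le> E" and "\<bar>b - a\<bar> \<le> 9 * E"
proof -
  define X where "X p = gradient (conjugate R) (dual_adjoint A p)" for p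
  define F where "F p = conj_real (dual_adjoint A p) - p \<bullet> yd" for p
  define g where "g p = blinfun_apply A (X p) - yd" for p
  have X: "\<exists>r. R (X p) = ereal r \<and>
      (\<forall>u. ereal (r + p \<bullet> blinfun_apply A (u - X p) + c * (norm (u - X p))\<^sup>2) \<le> R u) \<and>
      conj_real (dual_adjoint A p) = p \<bullet> blinfun_apply A (X p) - r" for p
    using gradient_conjugate[of "dual_adjoint A p"] unfolding X_def dual_adjoint_apply by metis
  have grad: "(F has_derivative (\<lambda>h. g p \<bullet> h)) (at p)" for p
  proof -
    have "(conj_real has_derivative (\<lambda>h. blinfun_apply h (X p))) (at (dual_adjoint A p))"
      using gradient_conjugate[of "dual_adjoint A p"] unfolding X_def by metis
    from has_derivative_compose[OF bounded_linear_imp_has_derivative[OF bounded_linear_dual_adjoint] this]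
    have "((\<lambda>p. conj_real (dual_adjoint A p)) has_derivative
        (\<lambda>h. h \<bullet> blinfun_apply A (X p))) (at p)"
      by (simp add: dual_adjoint_apply)
    then show ?thesis
      unfolding F_def[abs_def] g_def
      by (auto intro!: derivative_eq_intros simp: inner_simps inner_commute)
  qed
  have convex: "F q + g q \<bullet> (p - q) \<le> F p" for q p
  proof -
    obtain r where r: "R (X q) = ereal r"
      "conj_real (dual_adjoint A q) = q \<bullet> blinfun_apply A (X q) - r" using X by blast
    have "p \<bullet> blinfun_apply A (X q) - r \<le> conj_real (dual_adjoint A p)"
      using fenchel_young[OF r(1), of "dual_adjoint A p"] by (simp add: dual_adjoint_apply)
    then show ?thesis using r(2) by (simp add: F_def g_def inner_simps inner_commute)
  qed
  have x_eq: "x \<tau> = X (l \<tau>)" if "0 < \<tau>" for \<tau>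
    using flow that by (simp add: dual_gradient_flow_def X_def)
  have deriv: "(l has_vector_derivative - g (l \<tau>)) (at \<tau>)" if "0 < \<tau>" for \<tau>
  proof -
    have "(l has_vector_derivative yd - blinfun_apply A (x \<tau>)) (at \<tau>)"
      using flow that unfolding dual_gradient_flow_def by blast
    then show ?thesis by (simp add: g_def x_eq[OF that])
  qed
  have "continuous_on {0..} l"
    using flow unfolding dual_gradient_flow_def
    by (meson atLeast_iff continuous_on_eq_continuous_within has_vector_derivative_continuous)
  from gradient_flow_estimate[OF grad convex this deriv t, of \<mu>]
  have energy: "t * (F (l t) - F \<mu>) + (norm (l t - \<mu>))\<^sup>2 / 2 + t\<^sup>2 * (norm (g (l t)))\<^sup>2 / 2
      \<le> (norm \<mu>)\<^sup>2 / 2"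
    by (simp add: l0)
  obtain b where b: "R (x t) = ereal b"
    and growth: "\<And>u. ereal (b + l t \<bullet> blinfun_apply A (u - x t) + c * (norm (u - x t))\<^sup>2) \<le> R u"
    and Fl: "conj_real (dual_adjoint A (l t)) = l t \<bullet> blinfun_apply A (x t) - b"
    using X[of "l t"] unfolding x_eq[OF t] by blast
  define d where "d = a - b - l t \<bullet> (y - blinfun_apply A (x t))"
  have bregman: "bregman R (dual_adjoint A (l t)) xdag (x t) = ereal d"
    by (simp add: bregman_def a b d_def dual_adjoint_apply blinfun.diff_right inner_diff_right Axdag)
  have d_lower: "c * (norm (x t - xdag))\<^sup>2 \<le> d"
    using growth[of xdag] by (simp add: a d_def blinfun.diff_right inner_diff_right Axdag norm_minus_commute)
  have d_nonneg: "0 \<le> d" using c_pos by (intro order_trans[OF _ d_lower]) simp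
  have e_nonneg: "0 \<le> e" using multiplier[of xdag] by (simp add: a Axdag)
  have F\<mu>: "F \<mu> \<le> e - a - \<mu> \<bullet> (yd - y)"
  proof -
    obtain r where "R (X \<mu>) = ereal r"
      "conj_real (dual_adjoint A \<mu>) = \<mu> \<bullet> blinfun_apply A (X \<mu>) - r" using X by blast
    then show ?thesis using multiplier[of "X \<mu>"] by (simp add: F_def inner_simps)
  qed
  have "d - e - \<delta> * norm (l t - \<mu>) \<le> F (l t) - F \<mu>"
  proof -
    have "(l t - \<mu>) \<bullet> (yd - y) \<le> norm (l t - \<mu>) * norm (yd - y)" by (rule norm_cauchy_schwarz)
    also have "\<dots> \<le> norm (l t - \<mu>) * \<delta>" using noise by (rule mult_left_mono) simp
    finally have "(l t - \<mu>) \<bullet> (yd - y) \<le> \<delta> * norm (l t - \<mu>)" by (simp add: mult.commute)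
    then show ?thesis using F\<mu> by (simp add: F_def Fl d_def inner_simps)
  qed
  then have "t * (d - e - \<delta> * norm (l t - \<mu>)) \<le> t * (F (l t) - F \<mu>)" using t by simp
  with energy have energy': "t * (d - e - \<delta> * norm (l t - \<mu>)) + (norm (l t - \<mu>))\<^sup>2 / 2
      + t\<^sup>2 * (norm (g (l t)))\<^sup>2 / 2 \<le> (norm \<mu>)\<^sup>2 / 2" by linarith
  have "0 \<le> \<delta>" using noise norm_ge_zero order_trans by blast
  note bounds = error_terms_bound[OF t d_nonneg e_nonneg this norm_ge_zero norm_ge_zero norm_ge_zero energy' E]
  have "\<bar>l t \<bullet> (y - blinfun_apply A (x t))\<bar> \<le> norm (l t) * norm (y - blinfun_apply A (x t))"
    by (rule Cauchy_Schwarz_ineq2)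
  also have "\<dots> \<le> (norm (l t - \<mu>) + norm \<mu>) * (\<delta> + norm (g (l t)))"
  proof (rule mult_mono)
    show "norm (l t) \<le> norm (l t - \<mu>) + norm \<mu>" using norm_triangle_ineq[of "l t - \<mu>" \<mu>] by simp
    have "y - blinfun_apply A (x t) = (y - yd) + - g (l t)" by (simp add: g_def x_eq[OF t])
    then have "norm (y - blinfun_apply A (x t)) \<le> norm (y - yd) + norm (g (l t))"
      by (metis norm_minus_cancel norm_triangle_ineq)
    then show "norm (y - blinfun_apply A (x t)) \<le> \<delta> + norm (g (l t))"
      using noise by (simp add: norm_minus_commute)
  qed auto
  also have "\<dots> \<le> 8 * E" by (rule bounds(2))
  finally have "\<bar>b - a\<bar> \<le> 9 * E" using bounds(1) d_nonneg unfolding d_def by linarith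
  with b bregman d_lower bounds(1) show ?thesis by (rule that)
qed

end

theorem theorem2p7:
  fixes R :: "'x::banach \<Rightarrow> ereal"
    and A :: "'x \<Rightarrow>\<^sub>L ('y::{real_inner, banach})"
    and c0 :: real and y :: 'y and xdag :: 'x
    and yd :: "real \<Rightarrow> 'y"
    and x :: "real \<Rightarrow> real \<Rightarrow> 'x" and lam :: "real \<Rightarrow> real \<Rightarrow> 'y"
    and t :: "real \<Rightarrow> real"
  assumes "proper_fun R"
    and "lower_semicontinuous R"
    and "c0 > 0" and "strongly_convex c0 R"
    and "\<And>c::real. compactin weak_topology {u. R u \<le> ereal c}"
    and "\<exists>u. blinfun_apply A u = y \<and> R u < \<infinity>"
    and "minimizing_solution R A y xdag"
    and "\<And>\<delta>. \<delta> > 0 \<Longrightarrow> norm (yd \<delta> - y) \<le> \<delta>"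
    and "\<And>\<delta>. \<delta> > 0 \<Longrightarrow> dual_gradient_flow R A (yd \<delta>) (x \<delta>) (lam \<delta>)"
    and "\<And>\<delta>. \<delta> > 0 \<Longrightarrow> lam \<delta> 0 = 0"
    and "\<And>\<delta>. \<delta> > 0 \<Longrightarrow> t \<delta> > 0"
    and "filterlim t at_top (at_right 0)"
    and "((\<lambda>\<delta>. \<delta>\<^sup>2 * t \<delta>) \<longlongrightarrow> 0) (at_right 0)"
  shows "((\<lambda>\<delta>. R (x \<delta> (t \<delta>))) \<longlongrightarrow> R xdag) (at_right 0) \<and>
    ((\<lambda>\<delta>. bregman R (dual_adjoint A (lam \<delta> (t \<delta>))) xdag (x \<delta> (t \<delta>))) \<longlongrightarrow> 0) (at_right 0) \<and>
    ((\<lambda>\<delta>. norm (x \<delta> (t \<delta>) - xdag)) \<longlongrightarrow> 0) (at_right 0)"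
proof -
  interpret strongly_convex_functional R c0
    using assms(1-4) by unfold_locales
  have Axdag: "blinfun_apply A xdag = y" and "R xdag < \<infinity>"
    using assms(6,7) by (auto simp: minimizing_solution_def intro: le_less_trans)
  then obtain a where a: "R xdag = ereal a" using finiteE by blast
  let ?xd = "\<lambda>\<delta>. x \<delta> (t \<delta>)"
  let ?B = "\<lambda>\<delta>. bregman R (dual_adjoint A (lam \<delta> (t \<delta>))) xdag (?xd \<delta>)"
  define r where "r \<delta> = real_of_ereal (R (?xd \<delta>))" for \<delta>
  define D where "D \<delta> = real_of_ereal (?B \<delta>)" for \<delta>
  have estimate: "R (?xd \<delta>) = ereal (r \<delta>) \<and> ?B \<delta> = ereal (D \<delta>) \<and> c0 * (norm (?xd \<delta> - xdag))\<^sup>2 \<le> D \<delta> \<and>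
      D \<delta> \<le> (norm \<mu>)\<^sup>2 / (2 * t \<delta>) + e + \<delta>\<^sup>2 * t \<delta> \<and>
      \<bar>r \<delta> - a\<bar> \<le> 9 * ((norm \<mu>)\<^sup>2 / (2 * t \<delta>) + e + \<delta>\<^sup>2 * t \<delta>)"
    if "0 < \<delta>" and "\<And>u. ereal (a - e) \<le> R u + ereal (\<mu> \<bullet> (y - blinfun_apply A u))" for \<delta> e \<mu>
    using dual_gradient_flow_error_estimate[OF Axdag a assms(8-11)[OF that(1)] that(2) refl]
    unfolding r_def D_def by (metis real_of_ereal.simps(1))
  have small: "\<forall>\<^sub>F \<delta> in at_right 0. D \<delta> < \<epsilon> \<and> \<bar>r \<delta> - a\<bar> < \<epsilon>" if "0 < \<epsilon>" for \<epsilon>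
  proof -
    obtain \<mu> where \<mu>: "\<And>u. ereal (a - \<epsilon> / 10) \<le> R u + ereal (\<mu> \<bullet> (y - blinfun_apply A u))"
      using approximate_lagrange_multiplier[OF assms(7) a, of "\<epsilon> / 10"] \<open>0 < \<epsilon>\<close> by auto
    \<comment> \<open>The gap \<open>\<epsilon> / 10\<close> of the multiplier leaves room below \<open>\<epsilon> / 9\<close>, which the factor \<open>9\<close> of the estimate needs.\<close>
    define E where "E \<delta> = (norm \<mu>)\<^sup>2 / (2 * t \<delta>) + \<epsilon> / 10 + \<delta>\<^sup>2 * t \<delta>" for \<delta>
    have "((\<lambda>\<delta>. (norm \<mu>)\<^sup>2 / 2 / t \<delta>) \<longlongrightarrow> 0) (at_right 0)"
      by (rule tendsto_divide_0[OF tendsto_const filterlim_at_top_imp_at_infinity[OF assms(12)]])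
    then have "((\<lambda>\<delta>. (norm \<mu>)\<^sup>2 / (2 * t \<delta>)) \<longlongrightarrow> 0) (at_right 0)" by simp
    then have "(E \<longlongrightarrow> 0 + \<epsilon> / 10 + 0) (at_right 0)"
      unfolding E_def[abs_def] by (intro tendsto_add tendsto_const assms(13))
    then have "\<forall>\<^sub>F \<delta> in at_right 0. E \<delta> < \<epsilon> / 9"
      using \<open>0 < \<epsilon>\<close> by (intro order_tendstoD) auto
    moreover have "\<forall>\<^sub>F \<delta> in at_right (0::real). 0 < \<delta>" by (rule eventually_at_right_less)
    ultimately show ?thesis
    proof eventually_elim
      case (elim \<delta>)
      have "D \<delta> \<le> E \<delta>" "\<bar>r \<delta> - a\<bar> \<le> 9 * E \<delta>"
        using estimate[OF elim(2) \<mu>] unfolding E_def by blast+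
      then show ?case using elim(1) \<open>0 < \<epsilon>\<close> by (intro conjI) linarith+
    qed
  qed
  \<comment> \<open>Finiteness of both values and the growth bound do not depend on the multiplier, so that any one
    of them, here with gap \<open>1\<close>, makes them available.\<close>
  obtain \<mu> where \<mu>: "\<And>u. ereal (a - 1) \<le> R u + ereal (\<mu> \<bullet> (y - blinfun_apply A u))"
    using approximate_lagrange_multiplier[OF assms(7) a, of 1] by auto
  have pos: "\<forall>\<^sub>F \<delta> in at_right (0::real). 0 < \<delta>" by (rule eventually_at_right_less)
  note est = estimate[OF _ \<mu>]
  have lower: "0 \<le> D \<delta>" if "0 < \<delta>" for \<delta>
    using est[OF that] c_pos by (meson less_imp_le mult_nonneg_nonneg order_trans zero_le_power2)
  have r: "(r \<longlongrightarrow> a) (at_right 0)"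
  proof (rule tendstoI)
    fix \<epsilon> :: real assume "0 < \<epsilon>"
    from small[OF this] show "\<forall>\<^sub>F \<delta> in at_right 0. dist (r \<delta>) a < \<epsilon>"
      by eventually_elim (simp add: dist_real_def)
  qed
  have D: "(D \<longlongrightarrow> 0) (at_right 0)"
  proof (rule tendstoI)
    fix \<epsilon> :: real assume "0 < \<epsilon>"
    from small[OF this] pos show "\<forall>\<^sub>F \<delta> in at_right 0. dist (D \<delta>) 0 < \<epsilon>"
      by eventually_elim (use lower in auto)
  qed
  have "((\<lambda>\<delta>. ereal (r \<delta>)) \<longlongrightarrow> R xdag) (at_right 0)" using r by (simp add: a)
  moreover have "\<forall>\<^sub>F \<delta> in at_right 0. ereal (r \<delta>) = R (?xd \<delta>)"
    using pos by eventually_elim (use est in auto)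
  ultimately have R_lim: "((\<lambda>\<delta>. R (?xd \<delta>)) \<longlongrightarrow> R xdag) (at_right 0)"
    by (rule Lim_transform_eventually)
  have "((\<lambda>\<delta>. ereal (D \<delta>)) \<longlongrightarrow> 0) (at_right 0)" using D by (simp add: zero_ereal_def)
  moreover have "\<forall>\<^sub>F \<delta> in at_right 0. ereal (D \<delta>) = ?B \<delta>"
    using pos by eventually_elim (use est in auto)
  ultimately have B_lim: "(?B \<longlongrightarrow> 0) (at_right 0)" by (rule Lim_transform_eventually)
  have "((\<lambda>\<delta>. sqrt (D \<delta> / c0)) \<longlongrightarrow> sqrt (0 / c0)) (at_right 0)"
    using c_pos by (intro tendsto_intros D) auto
  then have sqrt_lim: "((\<lambda>\<delta>. sqrt (D \<delta> / c0)) \<longlongrightarrow> 0) (at_right 0)" by simp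
  have "\<forall>\<^sub>F \<delta> in at_right 0. norm (norm (?xd \<delta> - xdag)) \<le> sqrt (D \<delta> / c0)"
    using pos
  proof eventually_elim
    case (elim \<delta>)
    then show ?case using est[OF elim] c_pos by (auto intro!: real_le_rsqrt simp: field_simps)
  qed
  from Lim_null_comparison[OF this sqrt_lim] R_lim B_lim show ?thesis by blast
qed

end
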